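(* Let $s\in\mathbb{R}$, $k\ge0$, $k>s$, and $\phi\in W_2^s(\mathbb{R}^d)$. If $S_\phi(W_2^s)$ provides approximation order $k$, then $S_\phi(W_2^t)$ provides the same approximation order $k$ (in $W_2^t(\mathbb{R}^d)$) for any $t\le s$.
   Context: $\widehat f(\omega)=\int f(x)e^{-i\omega\cdot x}dx$. For $s\in\mathbb{R}$, $W_2^s=W_2^s(\mathbb{R}^d)$ is the space of tempered distributions $f$ with $\widehat f$ locally in $L_2(\mathbb{R}^d)$ and $\|f\|_{W_2^s}^2=\int(1+|\omega|)^{2s}|\widehat f(\omega)|^2d\omega<\infty$. For $\phi\in W_2^s$, $S_\phi(W_2^s)$ is the smallest closed subspace of $W_2^s$ containing $\phi$ and invariant under integer translations. For $k>s$, "$S_\phi(W_2^s)$ provides approximation order $k$" (in $W_2^s$) means: with $S^h=\{g(\cdot/h):g\in S_\phi(W_2^s)\}$, there is a constant $C$ such that $\inf_{g\in S^h}\|f-g\|_{W_2^s}\le Ch^{k-s}\|f\|_{W_2^k}$ for every $f\in W_2^k(\mathbb{R}^d)$ and every $h>0$. *)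

theory Defs
  imports "HOL-Analysis.Analysis"
begin

section \<open>Schwartz functions and test functions\<close>

text \<open>Lists of indices replace multi-indices: the list records the coordinate directions in which
  one differentiates successively.\<close>

fun iter_partial :: "'d::finite list \<Rightarrow> (real^'d \<Rightarrow> complex) \<Rightarrow> real^'d \<Rightarrow> complex" where
  "iter_partial [] f = f"
| "iter_partial (i # is) f =
     (\<lambda>x. frechet_derivative (iter_partial is f) (at x) (axis i 1))"

definition smooth :: "(real^'d::finite \<Rightarrow> complex) \<Rightarrow> bool" where
  "smooth f \<longleftrightarrow> (\<forall>is x. iter_partial is f differentiable (at x))"

definition schwartz_space :: "(real^'d::finite \<Rightarrow> complex) set" where
  "schwartz_space = {f. smooth f \<and>
     (\<forall>N is. bounded (range (\<lambda>x. of_real ((1 + norm x) ^ N) * iter_partial is f x)))}"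

definition schwartz_seminorm :: "nat \<Rightarrow> (real^'d::finite \<Rightarrow> complex) \<Rightarrow> real" where
  "schwartz_seminorm N f =
     (SUP (is, x) \<in> {is. length is \<le> N} \<times> UNIV. (1 + norm x) ^ N * cmod (iter_partial is f x))"

definition test_functions :: "(real^'d::finite \<Rightarrow> complex) set" where
  "test_functions = {f. smooth f \<and> compact (closure {x. f x \<noteq> 0})}"

definition fourier :: "(real^'d::finite \<Rightarrow> complex) \<Rightarrow> real^'d \<Rightarrow> complex" where
  "fourier f \<omega> = (LINT x|lborel. f x * exp (- \<i> * of_real (\<omega> \<bullet> x)))"


section \<open>Tempered distributions\<close>

type_synonym 'd functional = "(real^'d \<Rightarrow> complex) \<Rightarrow> complex"

text \<open>Since HOL functions are total, a functional on the Schwartz space is made to vanish outside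
  of it; in this way equality of distributions is equality in HOL, and the vector space operations
  are pointwise. Continuity is expressed through the increasing family of seminorms defining the
  topology of the Schwartz space.\<close>

definition tempered_distributions :: "'d::finite functional set" where
  "tempered_distributions = {u.
     (\<forall>\<psi>. \<psi> \<notin> schwartz_space \<longrightarrow> u \<psi> = 0) \<and>
     (\<forall>\<psi>\<in>schwartz_space. \<forall>\<eta>\<in>schwartz_space. u (\<lambda>x. \<psi> x + \<eta> x) = u \<psi> + u \<eta>) \<and>
     (\<forall>\<psi>\<in>schwartz_space. \<forall>c. u (\<lambda>x. c * \<psi> x) = c * u \<psi>) \<and>
     (\<exists>C N. \<forall>\<psi>\<in>schwartz_space. cmod (u \<psi>) \<le> C * schwartz_seminorm N \<psi>)}"

definition fourier_dist :: "'d::finite functional \<Rightarrow> 'd functional" where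
  "fourier_dist u = (\<lambda>\<psi>. if \<psi> \<in> schwartz_space then u (fourier \<psi>) else 0)"

text \<open>\<open>translate_dist j u\<close> is \<open>u(\<cdot> - j)\<close>, and \<open>dilate_dist h u\<close> is \<open>u(\<cdot> / h)\<close> for \<open>h > 0\<close>;
  the formulas are the change of variables in \<open>\<integral> u(x - j) \<psi>(x) dx\<close> and \<open>\<integral> u(x / h) \<psi>(x) dx\<close>.\<close>

definition translate_dist :: "real^'d \<Rightarrow> 'd::finite functional \<Rightarrow> 'd functional" where
  "translate_dist j u = (\<lambda>\<psi>. u (\<lambda>x. \<psi> (x + j)))"

definition dilate_dist :: "real \<Rightarrow> 'd::finite functional \<Rightarrow> 'd functional" where
  "dilate_dist h u = (\<lambda>\<psi>. of_real (h ^ CARD('d)) * u (\<lambda>x. \<psi> (h *\<^sub>R x)))"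

definition locally_L2 :: "(real^'d::finite \<Rightarrow> complex) \<Rightarrow> bool" where
  "locally_L2 g \<longleftrightarrow> g \<in> borel_measurable lborel \<and>
     (\<forall>K. compact K \<longrightarrow> set_integrable lborel K (\<lambda>x. (cmod (g x))\<^sup>2))"

definition represented_by :: "'d::finite functional \<Rightarrow> (real^'d \<Rightarrow> complex) \<Rightarrow> bool" where
  "represented_by u g \<longleftrightarrow> (\<forall>\<psi>\<in>test_functions. u \<psi> = (LINT x|lborel. g x * \<psi> x))"


section \<open>Sobolev spaces\<close>

text \<open>The locally square integrable function representing the Fourier transform is unique up to
  null sets, so the choice made here is irrelevant for the integrals below.\<close>

definition fourier_fun :: "'d::finite functional \<Rightarrow> real^'d \<Rightarrow> complex" where
  "fourier_fun u = (SOME g. locally_L2 g \<and> represented_by (fourier_dist u) g)"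

definition sobolev_space :: "real \<Rightarrow> 'd::finite functional set" where
  "sobolev_space s = {u \<in> tempered_distributions.
     (\<exists>g. locally_L2 g \<and> represented_by (fourier_dist u) g) \<and>
     integrable lborel (\<lambda>\<omega>. (1 + norm \<omega>) powr (2 * s) * (cmod (fourier_fun u \<omega>))\<^sup>2)}"

definition sobolev_norm :: "real \<Rightarrow> 'd::finite functional \<Rightarrow> real" where
  "sobolev_norm s u =
     sqrt (LINT \<omega>|lborel. (1 + norm \<omega>) powr (2 * s) * (cmod (fourier_fun u \<omega>))\<^sup>2)"


section \<open>Principal shift-invariant spaces and approximation order\<close>

definition closed_subspace :: "real \<Rightarrow> 'd::finite functional set \<Rightarrow> bool" where
  "closed_subspace s A \<longleftrightarrow> A \<subseteq> sobolev_space s \<and> A \<noteq> {} \<and>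
     (\<forall>f\<in>A. \<forall>g\<in>A. \<forall>a b :: complex. (\<lambda>\<psi>. a * f \<psi> + b * g \<psi>) \<in> A) \<and>
     (\<forall>f\<in>sobolev_space s. (\<forall>\<epsilon>>0. \<exists>g\<in>A. sobolev_norm s (f - g) < \<epsilon>) \<longrightarrow> f \<in> A)"

definition shift_invariant :: "'d::finite functional set \<Rightarrow> bool" where
  "shift_invariant A \<longleftrightarrow> (\<forall>f\<in>A. \<forall>j. (\<forall>i. j $ i \<in> \<int>) \<longrightarrow> translate_dist j f \<in> A)"

definition principal_space :: "real \<Rightarrow> 'd::finite functional \<Rightarrow> 'd functional set" where
  "principal_space s \<phi> = \<Inter> {A. closed_subspace s A \<and> shift_invariant A \<and> \<phi> \<in> A}"

text \<open>Meant for \<open>\<phi> \<in> sobolev_space s\<close> and \<open>k > s\<close>.\<close>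

definition provides_approximation_order :: "real \<Rightarrow> 'd::finite functional \<Rightarrow> real \<Rightarrow> bool" where
  "provides_approximation_order s \<phi> k \<longleftrightarrow>
     (\<exists>C. \<forall>f\<in>sobolev_space k. \<forall>h>0.
        (INF g \<in> dilate_dist h ` principal_space s \<phi>. sobolev_norm s (f - g))
          \<le> C * h powr (k - s) * sobolev_norm k f)"

end

theory Submission
  imports Defs "HOL-Computational_Algebra.Polynomial"
begin

text \<open>
  Write \<open>S\<^sup>h\<close> for the dilates \<open>g(\<cdot> / h)\<close> of the elements \<open>g\<close> of the principal space of \<open>\<phi>\<close> in
  \<open>W\<^sup>s\<close>. Convergence in \<open>W\<^sup>s\<close> implies convergence in \<open>W\<^sup>t\<close>, so these elements also lie in the principal space of
  \<open>\<phi>\<close> in \<open>W\<^sup>t\<close> (\<open>principal_space_mono\<close>); it suffices to build approximants from \<open>S\<^sup>h\<close> whose error is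
  small in \<open>W\<^sup>t\<close>.

  The hypothesis gives \<open>g \<in> S\<^sup>h\<close> whose error \<open>e = f - g\<close> has \<open>W\<^sup>s\<close> norm at most \<open>C h\<^sup>k\<^sup>-\<^sup>s \<parallel>f\<parallel>\<^sub>k\<close>, and the
  exponent has to be improved to \<open>k - t\<close>. Cut \<open>e\<close> sharply at frequency \<open>\<epsilon> / h\<close>. The
  high-frequency part is already small enough, since there the weight of \<open>W\<^sup>t\<close> is smaller than that of
  \<open>W\<^sup>s\<close> by the factor \<open>(\<epsilon> / h)\<^sup>t\<^sup>-\<^sup>s\<close>. The low-frequency part \<open>v\<close> gains nothing in this
  way, but it belongs to \<open>W\<^sup>k\<close>, and its norm there is at most
  \<open>(1 + \<epsilon> / h)\<^sup>k\<^sup>-\<^sup>s C h\<^sup>k\<^sup>-\<^sup>s \<parallel>f\<parallel>\<^sub>k \<le> (2\<epsilon>)\<^sup>k\<^sup>-\<^sup>s C \<parallel>f\<parallel>\<^sub>k\<close> when \<open>h \<le> \<epsilon>\<close>. As \<open>k > s\<close>, a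
  small fixed \<open>\<epsilon>\<close> makes this at most half of \<open>\<parallel>f\<parallel>\<^sub>k\<close>. So \<open>v\<close> can be approximated from \<open>S\<^sup>h\<close> in turn, and after
  \<open>n\<close> rounds the accumulated high-frequency errors form a geometric series of size
  \<open>h\<^sup>k\<^sup>-\<^sup>t \<parallel>f\<parallel>\<^sub>k\<close>, while the remaining low-frequency part is exponentially small in \<open>n\<close>.
  For \<open>h > \<epsilon>\<close> the approximant 0 is good enough. The splitting is \<open>frequency_split\<close>.

  The analytic groundwork makes the low-frequency part of a distribution available: the Fourier
  transform of an element of \<open>W\<^sup>s\<close> must be determined up to null sets (\<open>represented_by_unique\<close>, from explicit bump
  functions), and the truncated function must be the Fourier transform of a tempered
  distribution (\<open>low_pass_filter\<close>). The latter rests on Fourier inversion for test functions, which is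
  needed only up to a nonzero constant (\<open>fourier_inversion\<close>). Translates and dilates of a distribution remain in
  \<open>W\<^sup>s\<close> by \<open>sobolev_affine\<close>, which treats both at once.
\<close>

section \<open>Calculus of smooth functions\<close>

lemma iter_partial_1_eq:
  assumes "(f has_derivative D) (at x)"
  shows "iter_partial [i] f x = D (axis i 1)"
  using frechet_derivative_at[OF assms] by simp

text \<open>Smoothness is proved by exhibiting a class of differentiable functions that is stable under
  partial derivatives, much like coinduction.\<close>

lemma smooth_coinduct:
  assumes "f \<in> P"
    and diff: "\<And>f x. f \<in> P \<Longrightarrow> f differentiable (at x)"
    and part: "\<And>f i. f \<in> P \<Longrightarrow> iter_partial [i] f \<in> P"
  shows "smooth f"
proof -
  have "iter_partial is f \<in> P" for "is"
  proof (induction "is")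
    case (Cons i "is")
    from part[OF this, of i] show ?case by simp
  qed (simp add: assms)
  with diff show ?thesis by (auto simp: smooth_def)
qed

lemma smooth_differentiable: "smooth f \<Longrightarrow> f differentiable (at x)"
  unfolding smooth_def by (metis iter_partial.simps(1))

lemma smooth_has_derivative:
  "smooth f \<Longrightarrow> (f has_derivative frechet_derivative f (at x)) (at x)"
  using smooth_differentiable frechet_derivative_works by blast

lemma smooth_iter_partial: "smooth f \<Longrightarrow> smooth (iter_partial is f)"
proof -
  have "iter_partial js (iter_partial is f) = iter_partial (js @ is) f" for js
    by (induction js) simp_all
  then show "smooth f \<Longrightarrow> smooth (iter_partial is f)"
    unfolding smooth_def by metis
qed

lemma smooth_continuous_on: "smooth f \<Longrightarrow> continuous_on S f"
  by (meson differentiable_imp_continuous_within continuous_at_imp_continuous_on smooth_differentiable)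

lemma smooth_borel_measurable: "smooth f \<Longrightarrow> f \<in> borel_measurable borel"
  by (rule borel_measurable_continuous_onI) (rule smooth_continuous_on)

lemma iter_partial_1_add:
  assumes "f differentiable (at x)" "g differentiable (at x)"
  shows "iter_partial [i] (\<lambda>x. f x + g x) x = iter_partial [i] f x + iter_partial [i] g x"
proof -
  note d = assms[unfolded frechet_derivative_works]
  show ?thesis using iter_partial_1_eq[OF has_derivative_add[OF d]] by simp
qed

lemma iter_partial_1_mult:
  assumes "f differentiable (at x)" "g differentiable (at x)"
  shows "iter_partial [i] (\<lambda>x. f x * g x) x
    = f x * iter_partial [i] g x + iter_partial [i] f x * g x"
proof -
  note d = assms[unfolded frechet_derivative_works]
  show ?thesis using iter_partial_1_eq[OF has_derivative_mult[OF d]] by simp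
qed

text \<open>The product rule leads out of the set of products of smooth functions but not out of the
  algebra they generate, so this algebra is a suitable class for \<open>smooth_coinduct\<close>. It serves only to
  prove \<open>smooth_add\<close> and \<open>smooth_mult\<close>.\<close>

inductive_set smooth_alg :: "(real^'d::finite \<Rightarrow> complex) set" where
  base: "smooth f \<Longrightarrow> f \<in> smooth_alg"
| add: "f \<in> smooth_alg \<Longrightarrow> g \<in> smooth_alg \<Longrightarrow> (\<lambda>x. f x + g x) \<in> smooth_alg"
| mult: "f \<in> smooth_alg \<Longrightarrow> g \<in> smooth_alg \<Longrightarrow> (\<lambda>x. f x * g x) \<in> smooth_alg"

lemma smooth_alg_smooth:
  assumes "f \<in> smooth_alg"
  shows "smooth f"
proof -
  have diff: "f differentiable (at x)" if "f \<in> smooth_alg" for f :: "real^'d \<Rightarrow> complex" and x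
    using that by induction (auto simp: smooth_differentiable intro: differentiable_mult)
  have "iter_partial [i] f \<in> smooth_alg" if "f \<in> smooth_alg" for f :: "real^'d \<Rightarrow> complex" and i
    using that
  proof induction
    case (base f)
    then show ?case by (intro smooth_alg.base smooth_iter_partial)
  next
    case (add f g)
    have "iter_partial [i] (\<lambda>x. f x + g x) = (\<lambda>x. iter_partial [i] f x + iter_partial [i] g x)"
      by (rule ext, rule iter_partial_1_add) (simp_all add: diff add)
    then show ?case using smooth_alg.add[OF add.IH] by (simp only:)
  next
    case (mult f g)
    have "iter_partial [i] (\<lambda>x. f x * g x)
        = (\<lambda>x. f x * iter_partial [i] g x + iter_partial [i] f x * g x)"
      by (rule ext, rule iter_partial_1_mult) (simp_all add: diff mult)
    moreover have "\<dots> \<in> smooth_alg"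
      by (rule smooth_alg.add[OF smooth_alg.mult[OF mult.hyps(1) mult.IH(2)]
            smooth_alg.mult[OF mult.IH(1) mult.hyps(2)]])
    ultimately show ?case by (simp only:)
  qed
  from smooth_coinduct[OF assms diff this] show ?thesis .
qed

lemma smooth_add: "smooth f \<Longrightarrow> smooth g \<Longrightarrow> smooth (\<lambda>x. f x + g x)"
  by (rule smooth_alg_smooth[OF smooth_alg.add[OF smooth_alg.base smooth_alg.base]])

lemma smooth_mult: "smooth f \<Longrightarrow> smooth g \<Longrightarrow> smooth (\<lambda>x. f x * g x)"
  by (rule smooth_alg_smooth[OF smooth_alg.mult[OF smooth_alg.base smooth_alg.base]])

lemma smooth_const: "smooth (\<lambda>x. c)"
proof (rule smooth_coinduct[where P = "range (\<lambda>c x. c)"])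
  fix f :: "real^'a \<Rightarrow> complex" and i assume "f \<in> range (\<lambda>c x. c)"
  then obtain c where f: "f = (\<lambda>x. c)" by auto
  have "iter_partial [i] f = (\<lambda>x. 0)"
    unfolding f by (rule ext) (simp add: frechet_derivative_const)
  then show "iter_partial [i] f \<in> range (\<lambda>c x. c)" by auto
qed auto

lemma smooth_sum: "finite I \<Longrightarrow> (\<And>i. i \<in> I \<Longrightarrow> smooth (f i)) \<Longrightarrow> smooth (\<lambda>x. \<Sum>i\<in>I. f i x)"
  by (induction rule: finite_induct) (simp_all add: smooth_const smooth_add)

lemma smooth_prod: "finite I \<Longrightarrow> (\<And>i. i \<in> I \<Longrightarrow> smooth (f i)) \<Longrightarrow> smooth (\<lambda>x. \<Prod>i\<in>I. f i x)"
  by (induction rule: finite_induct) (simp_all add: smooth_const smooth_mult)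

lemma smooth_of_partials:
  assumes "\<And>x. f differentiable (at x)" "\<And>i. smooth (iter_partial [i] f)"
  shows "smooth f"
proof (rule smooth_coinduct[where P = "insert f (Collect smooth)"])
  fix g i assume "g \<in> insert f (Collect smooth)"
  then have "smooth (iter_partial [i] g)"
    using assms(2) smooth_iter_partial by blast
  then show "iter_partial [i] g \<in> insert f (Collect smooth)" by blast
qed (use assms(1) smooth_differentiable in auto)

lemma smooth_coordinate: "smooth (\<lambda>x. of_real (x $ i))"
proof (rule smooth_of_partials)
  have d: "((\<lambda>x. complex_of_real (x $ i)) has_derivative (\<lambda>v. of_real (v $ i))) (at x)" for x
    by (rule bounded_linear.has_derivative[OF bounded_linear_of_real] bounded_linear_imp_has_derivative
        bounded_linear_compose[OF bounded_linear_of_real bounded_linear_vec_nth])+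
  then show "(\<lambda>x. complex_of_real (x $ i)) differentiable (at x)" for x
    unfolding differentiable_def by blast
  fix j
  have "iter_partial [j] (\<lambda>x. complex_of_real (x $ i)) = (\<lambda>x. of_real (axis j 1 $ i))"
    by (rule ext) (rule iter_partial_1_eq[OF d])
  then show "smooth (iter_partial [j] (\<lambda>x. complex_of_real (x $ i)))"
    by (simp only: smooth_const)
qed

lemma has_derivative_character:
  "((\<lambda>x. c * exp (\<i> * complex_of_real (a \<bullet> x))) has_derivative
      (\<lambda>v. c * (\<i> * of_real (a \<bullet> v)) * exp (\<i> * of_real (a \<bullet> x)))) (at x)"
proof -
  have l: "((\<lambda>x. \<i> * complex_of_real (a \<bullet> x)) has_derivative (\<lambda>v. \<i> * of_real (a \<bullet> v))) (at x)"
    by (rule bounded_linear_imp_has_derivative)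
      (rule bounded_linear_compose[OF bounded_linear_mult_right
        bounded_linear_compose[OF bounded_linear_of_real bounded_linear_inner_right]])
  have "(exp has_derivative (\<lambda>z. exp (\<i> * complex_of_real (a \<bullet> x)) * z)) (at (\<i> * complex_of_real (a \<bullet> x)))"
    using DERIV_exp has_field_derivative_def by blast
  from has_derivative_mult_right[OF has_derivative_compose[OF l this], of c] show ?thesis
    by (simp add: ac_simps)
qed

lemma smooth_character: "smooth (\<lambda>x. exp (\<i> * of_real (a \<bullet> x)))"
proof (rule smooth_coinduct[where P = "range (\<lambda>c x. c * exp (\<i> * of_real (a \<bullet> x)))"])
  fix f :: "real^'a \<Rightarrow> complex" assume "f \<in> range (\<lambda>c x. c * exp (\<i> * of_real (a \<bullet> x)))"
  then obtain c where f: "f = (\<lambda>x. c * exp (\<i> * of_real (a \<bullet> x)))" by auto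
  show "f differentiable (at x)" for x
    using has_derivative_character unfolding f differentiable_def by blast
  have "iter_partial [j] f
      = (\<lambda>x. c * (\<i> * of_real (a \<bullet> axis j 1)) * exp (\<i> * of_real (a \<bullet> x)))" for j
    unfolding f by (rule ext) (rule iter_partial_1_eq[OF has_derivative_character])
  then show "iter_partial [j] f \<in> range (\<lambda>c x. c * exp (\<i> * of_real (a \<bullet> x)))" for j
    by (metis rangeI)
qed (auto intro!: range_eqI[where x=1])

lemma iter_partial_affine:
  assumes "smooth f"
  shows "iter_partial is (\<lambda>x. f (h *\<^sub>R x + j))
    = (\<lambda>x. of_real h ^ length is * iter_partial is f (h *\<^sub>R x + j))"
    and "smooth (\<lambda>x. f (h *\<^sub>R x + j))"
proof -
  have d: "((\<lambda>x. c * iter_partial is f (h *\<^sub>R x + j)) has_derivative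
      (\<lambda>v. c * frechet_derivative (iter_partial is f) (at (h *\<^sub>R x + j)) (h *\<^sub>R v))) (at x)" for c "is" x
  proof -
    have "((iter_partial is f \<circ> (\<lambda>x. h *\<^sub>R x + j)) has_derivative
      frechet_derivative (iter_partial is f) (at (h *\<^sub>R x + j)) \<circ> (\<lambda>v. h *\<^sub>R v)) (at x)"
      by (rule diff_chain_at)
        (auto intro!: derivative_eq_intros smooth_has_derivative smooth_iter_partial assms)
    then show ?thesis
      by (intro has_derivative_mult_right) (simp add: o_def)
  qed
  have lin: "frechet_derivative (iter_partial is f) (at y) (h *\<^sub>R v)
      = of_real h * frechet_derivative (iter_partial is f) (at y) v" for "is" y v
    using linear_frechet_derivative[OF smooth_differentiable[OF smooth_iter_partial[OF assms]]]
    by (metis linear_scale scaleR_conv_of_real)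
  show *: "iter_partial is (\<lambda>x. f (h *\<^sub>R x + j))
    = (\<lambda>x. of_real h ^ length is * iter_partial is f (h *\<^sub>R x + j))" for "is"
  proof (induction "is")
    case (Cons i "is")
    have "iter_partial (i # is) (\<lambda>x. f (h *\<^sub>R x + j)) x
        = iter_partial [i] (\<lambda>x. of_real h ^ length is * iter_partial is f (h *\<^sub>R x + j)) x" for x
      using Cons by simp
    also have "\<dots> x = of_real h ^ length (i # is) * iter_partial (i # is) f (h *\<^sub>R x + j)" for x
      by (subst iter_partial_1_eq[OF d]) (simp add: lin)
    finally show ?case by (rule ext)
  qed simp
  show "smooth (\<lambda>x. f (h *\<^sub>R x + j))"
    unfolding smooth_def * using d by (auto simp: differentiable_def)
qed

section \<open>Bump functions and uniqueness of the representing function\<close>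

text \<open>The polynomial factor makes this family closed under differentiation, so that smoothness
  at the origin needs a single derivative computation (\<open>DERIV_flat_exp\<close>) rather than one for each order.\<close>

definition flat_exp :: "real poly \<Rightarrow> real \<Rightarrow> real" where
  "flat_exp p t = (if t > 0 then poly p (1 / t) * exp (- (1 / t)) else 0)"

lemma tendsto_poly_div_exp_0: "((\<lambda>u::real. u ^ k * poly p u / exp u) \<longlongrightarrow> 0) at_top"
proof (induction p arbitrary: k)
  case (pCons a p)
  have "((\<lambda>u. a * (u ^ k / exp u) + u ^ Suc k * poly p u / exp u) \<longlongrightarrow> a * 0 + 0) at_top"
    by (intro tendsto_intros tendsto_power_div_exp_0 pCons.IH)
  then show ?case by (simp add: algebra_simps add_divide_distrib)
qed simp

lemma DERIV_flat_exp:
  "(flat_exp p has_real_derivative flat_exp ([:0, 0, 1:] * (p - pderiv p)) t) (at t)"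
proof -
  consider "t < 0" | "t > 0" | "t = 0" by linarith
  then show ?thesis
  proof cases
    case 1
    have ev: "eventually (\<lambda>x. flat_exp p x = 0) (nhds t)"
      using eventually_nhds_in_open[of "{..<0}" t] 1
      by (auto simp: flat_exp_def elim!: eventually_mono)
    show ?thesis
      unfolding DERIV_cong_ev[OF refl ev refl] using 1 by (simp add: flat_exp_def)
  next
    case 2
    have ev: "eventually (\<lambda>x. flat_exp p x = poly p (1 / x) * exp (- (1 / x))) (nhds t)"
      using eventually_nhds_in_open[of "{0<..}" t] 2
      by (auto simp: flat_exp_def elim!: eventually_mono)
    show ?thesis
      unfolding DERIV_cong_ev[OF refl ev refl] using 2
      by (auto intro!: derivative_eq_intros DERIV_chain2[OF poly_DERIV]
          simp: flat_exp_def field_simps power2_eq_square)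
  next
    case 3
    have "((\<lambda>x. poly (pCons 0 p) (inverse x) / exp (inverse x)) \<longlongrightarrow> 0) (at_right (0::real))"
      using filterlim_compose[OF tendsto_poly_div_exp_0[of 0 "pCons 0 p"] filterlim_inverse_at_top_right]
      by simp
    then have "((\<lambda>x. flat_exp p x / x) \<longlongrightarrow> 0) (at_right 0)"
      by (rule Lim_transform_eventually)
        (auto simp: eventually_at_filter flat_exp_def field_simps exp_minus)
    moreover have "((\<lambda>x. flat_exp p x / x) \<longlongrightarrow> 0) (at_left 0)"
      by (rule Lim_transform_eventually[OF tendsto_const])
        (auto simp: eventually_at_filter flat_exp_def)
    ultimately have "((\<lambda>x. flat_exp p x / x) \<longlongrightarrow> 0) (at 0)"
      by (simp add: filterlim_split_at)
    then show ?thesis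
      unfolding 3 by (simp add: DERIV_def flat_exp_def)
  qed
qed

lemma smooth_flat_exp: "smooth (\<lambda>x. of_real (flat_exp p (c * x $ i + a)))"
proof (rule smooth_coinduct[where P = "range (\<lambda>p x. of_real (flat_exp p (c * x $ i + a)))"])
  let ?D = "\<lambda>p. [:0, 0, 1:] * (p - pderiv p)"
  have d: "((\<lambda>x::real^'a. complex_of_real (flat_exp p (c * x $ i + a))) has_derivative
      (\<lambda>v. of_real (flat_exp (?D p) (c * x $ i + a) * (c * v $ i)))) (at x)" for x p
  proof -
    have l: "((\<lambda>x::real^'a. c * x $ i + a) has_derivative (\<lambda>v. c * v $ i)) (at x)"
      by (auto intro!: derivative_eq_intros bounded_linear_imp_has_derivative bounded_linear_vec_nth)
    have "(flat_exp p has_derivative (*) (flat_exp (?D p) (c * x $ i + a))) (at (c * x $ i + a))"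
      using DERIV_flat_exp unfolding has_field_derivative_def .
    from bounded_linear.has_derivative[OF bounded_linear_of_real has_derivative_compose[OF l this]]
    show ?thesis .
  qed
  fix f :: "real^'a \<Rightarrow> complex" assume "f \<in> range (\<lambda>p x. of_real (flat_exp p (c * x $ i + a)))"
  then obtain p where f: "f = (\<lambda>x. of_real (flat_exp p (c * x $ i + a)))" by auto
  show "f differentiable (at x)" for x
    using d unfolding f differentiable_def by blast
  have "iter_partial [j] f
      = (\<lambda>x. of_real (flat_exp (smult (c * axis j 1 $ i) (?D p)) (c * x $ i + a)))" for j
    unfolding f by (rule ext, subst iter_partial_1_eq[OF d]) (simp add: flat_exp_def)
  then show "iter_partial [j] f \<in> range (\<lambda>p x. of_real (flat_exp p (c * x $ i + a)))" for j
    by (metis rangeI)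
qed auto

text \<open>As \<open>n\<close> grows, each factor tends to 1 inside the box because \<open>exp (- 1 / (n u))\<close> does so for
  \<open>u > 0\<close>; no plateau is needed for a bump that approximates the indicator boundedly.\<close>

definition box_bump :: "nat \<Rightarrow> real^'d \<Rightarrow> real^'d \<Rightarrow> real^'d::finite \<Rightarrow> real" where
  "box_bump n a b x =
     (\<Prod>i\<in>UNIV. flat_exp 1 (n * x $ i - n * a $ i) * flat_exp 1 (n * b $ i - n * x $ i))"

lemma flat_exp_1_bounds: "0 \<le> flat_exp 1 t" "flat_exp 1 t \<le> 1"
  by (auto simp: flat_exp_def)

lemma flat_exp_1_pos_iff: "0 < flat_exp 1 t \<longleftrightarrow> t > 0"
  by (auto simp: flat_exp_def)

lemma box_bump_bounds: "0 \<le> box_bump n a b x" "box_bump n a b x \<le> 1"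
  unfolding box_bump_def
  by (auto intro!: prod_nonneg prod_le_1 mult_le_one simp: flat_exp_1_bounds)

lemma box_bump_zero: "x \<notin> box a b \<Longrightarrow> box_bump n a b x = 0"
proof -
  assume "x \<notin> box a b"
  then obtain i where "x $ i \<le> a $ i \<or> b $ i \<le> x $ i"
    by (auto simp: mem_box_cart not_less)
  then have "n * x $ i - n * a $ i \<le> 0 \<or> n * b $ i - n * x $ i \<le> 0"
    by (auto simp: mult_left_mono)
  then have "flat_exp 1 (n * x $ i - n * a $ i) * flat_exp 1 (n * b $ i - n * x $ i) = 0"
    by (auto simp: flat_exp_def)
  then show ?thesis
    unfolding box_bump_def by (subst prod_zero_iff) auto
qed

lemma box_bump_pos: "x \<in> box a b \<Longrightarrow> n > 0 \<Longrightarrow> 0 < box_bump n a b x"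
  unfolding box_bump_def
  by (intro prod_pos ballI mult_pos_pos) (auto simp: mem_box_cart flat_exp_1_pos_iff)

lemma box_bump_tendsto: "(\<lambda>n. box_bump n a b x) \<longlonglongrightarrow> indicator (box a b) x"
proof (cases "x \<in> box a b")
  case False
  then show ?thesis by (simp add: box_bump_zero)
next
  case True
  have *: "(\<lambda>n. flat_exp 1 (n * s - n * t)) \<longlonglongrightarrow> 1" if "s > t" for s t :: real
  proof -
    have "(\<lambda>n. exp (- (inverse (real n) * (1 / (s - t))))) \<longlonglongrightarrow> exp (- (0 * (1 / (s - t))))"
      by (intro tendsto_intros lim_inverse_n)
    then have "(\<lambda>n. exp (- (inverse (real n) * (1 / (s - t))))) \<longlonglongrightarrow> 1" by simp
    then show ?thesis
    proof (rule Lim_transform_eventually)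
      show "\<forall>\<^sub>F n in sequentially. exp (- (inverse (real n) * (1 / (s - t)))) = flat_exp 1 (n * s - n * t)"
        using eventually_gt_at_top[of 0]
        by eventually_elim (use that in \<open>simp add: flat_exp_def divide_inverse
          flip: right_diff_distrib inverse_mult_distrib\<close>)
    qed
  qed
  have "(\<lambda>n. box_bump n a b x) \<longlonglongrightarrow> (\<Prod>i\<in>(UNIV::'a set). 1 * 1)"
    unfolding box_bump_def using True by (intro tendsto_intros *) (auto simp: mem_box_cart)
  then show ?thesis using True by simp
qed

lemma test_functionsI: "smooth f \<Longrightarrow> bounded {x. f x \<noteq> 0} \<Longrightarrow> f \<in> test_functions"
  by (simp add: test_functions_def)

lemma test_functionsD: "f \<in> test_functions \<Longrightarrow> smooth f" "f \<in> test_functions \<Longrightarrow> bounded {x. f x \<noteq> 0}"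
  by (simp_all add: test_functions_def)

lemma box_bump_test_function: "(\<lambda>x. complex_of_real (box_bump n a b x)) \<in> test_functions"
proof (rule test_functionsI)
  have "smooth (\<lambda>x. \<Prod>i\<in>UNIV. complex_of_real (flat_exp 1 (real n * x $ i + (- n * a $ i)))
      * of_real (flat_exp 1 ((- real n) * x $ i + n * b $ i)))"
    by (intro smooth_prod smooth_mult smooth_flat_exp) auto
  then show "smooth (\<lambda>x. complex_of_real (box_bump n a b x))"
    by (simp add: box_bump_def algebra_simps)
  have "{x. complex_of_real (box_bump n a b x) \<noteq> 0} \<subseteq> box a b"
    using box_bump_zero by auto
  then show "bounded {x. complex_of_real (box_bump n a b x) \<noteq> 0}"
    by (rule bounded_subset[OF bounded_box])
qed

text \<open>Bumps approximate the indicators of boxes boundedly, so \<open>g\<close> has integral zero over every box.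
  Boxes generate the Borel sets and are stable under intersection; hence, within a fixed box, the integral over every
  Borel set vanishes, which forces \<open>g = 0\<close> almost everywhere.\<close>

lemma AE_zero_if_orthogonal_to_test_functions:
  fixes g :: "real^'d::finite \<Rightarrow> complex"
  assumes g[measurable]: "g \<in> borel_measurable lborel"
    and int: "\<And>K. compact K \<Longrightarrow> set_integrable lborel K g"
    and zero: "\<And>\<psi>. \<psi> \<in> test_functions \<Longrightarrow> (LINT x|lborel. g x * \<psi> x) = 0"
  shows "AE x in lborel. g x = 0"
proof -
  have intb: "set_integrable lborel (box a b) g" for a b
    by (rule set_integrable_subset[OF int[of "cbox a b"]]) (auto simp: box_subset_cbox)
  have box0: "(LINT x:box a b|lborel. g x) = 0" for a b
  proof -
    have "(\<lambda>n. LINT x|lborel. g x * of_real (box_bump n a b x))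
        \<longlonglongrightarrow> (LINT x|lborel. indicator (box a b) x *\<^sub>R g x)"
    proof (rule integral_dominated_convergence[where w="\<lambda>x. norm (indicator (box a b) x *\<^sub>R g x)"])
      show "integrable lborel (\<lambda>x. norm (indicator (box a b) x *\<^sub>R g x))"
        using intb[of a b] unfolding set_integrable_def by (rule integrable_norm)
      show "(\<lambda>x. g x * of_real (box_bump n a b x)) \<in> borel_measurable lborel" for n
        using smooth_borel_measurable[OF test_functionsD(1)[OF box_bump_test_function[of n a b]]]
        by measurable
      have "(\<lambda>n. g x * of_real (box_bump n a b x)) \<longlonglongrightarrow> g x * of_real (indicator (box a b) x)" for x
        by (intro tendsto_intros box_bump_tendsto)
      then show "AE x in lborel. (\<lambda>n. g x * of_real (box_bump n a b x)) \<longlonglongrightarrow> indicator (box a b) x *\<^sub>R g x"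
        by (simp add: scaleR_conv_of_real mult.commute)
      have "norm (g x * of_real (box_bump n a b x)) \<le> norm (indicator (box a b) x *\<^sub>R g x)" for n x
        using box_bump_bounds[of n a b x] box_bump_zero[of x a b n]
        by (cases "x \<in> box a b") (auto simp: norm_mult mult_left_le)
      then show "AE x in lborel. norm (g x * of_real (box_bump n a b x))
          \<le> norm (indicator (box a b) x *\<^sub>R g x)" for n
        by simp
    qed simp
    moreover have "(LINT x|lborel. g x * of_real (box_bump n a b x)) = 0" for n
      by (rule zero) (rule box_bump_test_function)
    ultimately show ?thesis
      unfolding set_lebesgue_integral_def by (simp add: LIMSEQ_const_iff)
  qed
  define Q :: "nat \<Rightarrow> (real^'d) set" where "Q n = box (- (real n *\<^sub>R One)) (real n *\<^sub>R One)" for n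
  have AEQ: "AE x in lborel. indicator (Q n) x *\<^sub>R g x = 0" for n
  proof (rule sigma_finite_measure.density_zero[OF lborel.sigma_finite_measure_axioms])
    let ?h = "\<lambda>x. indicator (Q n) x *\<^sub>R g x"
    show h: "integrable lborel ?h"
      using intb unfolding Q_def set_integrable_def .
    have hs: "set_integrable lborel A ?h" if "A \<in> sets borel" for A
      using integrable_mult_indicator[OF _ h] that unfolding set_integrable_def by simp
    have "A \<in> sigma_sets UNIV (range (\<lambda>(a, b). box a b))" if "A \<in> sets borel" for A :: "(real^'d) set"
      using that unfolding borel_eq_box by simp
    moreover have "(LINT x:A|lborel. ?h x) = 0"
      if "A \<in> sigma_sets UNIV (range (\<lambda>(a, b). box a b))" for A :: "(real^'d) set"
    proof (rule sigma_sets_induct_disjoint[OF _ _ that, where P="\<lambda>A. (LINT x:A|lborel. ?h x) = 0"])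
      show "Int_stable (range (\<lambda>(a, b). box a b :: (real^'d) set))"
        by (auto simp: Int_stable_def box_Int_box)
      show "(LINT x:A|lborel. ?h x) = 0" if "A \<in> range (\<lambda>(a, b). box a b)" for A
      proof -
        from that obtain a b where A: "A = box a b" by auto
        obtain c d where cd: "box a b \<inter> Q n = box c d"
          unfolding Q_def using box_Int_box by blast
        have "(LINT x:A|lborel. ?h x) = (LINT x:box c d|lborel. g x)"
          unfolding cd[symmetric] A set_lebesgue_integral_def
          by (rule Bochner_Integration.integral_cong) (auto simp: indicator_def)
        then show ?thesis by (simp add: box0)
      qed
      fix A assume A: "A \<in> sigma_sets UNIV (range (\<lambda>(a, b). box a b :: (real^'d) set))"
        "(LINT x:A|lborel. ?h x) = 0"
      then have Ab: "A \<in> sets borel" unfolding borel_eq_box by simp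
      have "(LINT x:UNIV-A|lborel. ?h x) = (LINT x|lborel. ?h x) - (LINT x:A|lborel. ?h x)"
        unfolding set_lebesgue_integral_def
          Bochner_Integration.integral_diff[OF h hs[OF Ab, unfolded set_integrable_def], symmetric]
        by (rule Bochner_Integration.integral_cong) (auto simp: indicator_def)
      also have "(LINT x|lborel. ?h x) = 0"
        using box0 unfolding set_lebesgue_integral_def Q_def by blast
      finally show "(LINT x:UNIV-A|lborel. ?h x) = 0" using A by simp
    next
      fix A :: "nat \<Rightarrow> (real^'d) set"
      assume A: "disjoint_family A" "range A \<subseteq> sigma_sets UNIV (range (\<lambda>(a, b). box a b))"
        "\<And>i. (LINT x:A i|lborel. ?h x) = 0"
      have "A i \<in> sets borel" for i using A(2) unfolding borel_eq_box by auto
      then show "(LINT x:(\<Union>i. A i)|lborel. ?h x) = 0"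
        using A by (subst lebesgue_integral_countable_add) (auto intro!: hs simp: disjoint_family_on_def)
    qed (auto simp: set_lebesgue_integral_def)
    ultimately show "\<And>A. A \<in> sets lborel \<Longrightarrow> (LINT x:A|lborel. ?h x) = 0" by simp
  qed
  have "AE x in lborel. \<forall>n. indicator (Q n) x *\<^sub>R g x = 0"
    unfolding AE_all_countable using AEQ by blast
  then show ?thesis
  proof eventually_elim
    case (elim x)
    have "x \<in> (\<Union>n. Q n)" unfolding Q_def UN_box_eq_UNIV by simp
    then obtain n where "x \<in> Q n" by blast
    then show ?case using spec[OF elim, of n] by simp
  qed
qed

lemma locally_L2_set_integrable:
  assumes "locally_L2 g" "compact K"
  shows "set_integrable lborel K g"
proof -
  have [measurable]: "g \<in> borel_measurable borel" and K[measurable]: "K \<in> sets borel"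
    using assms borel_compact unfolding locally_L2_def by auto
  have *: "integrable lborel (\<lambda>x. indicator K x *\<^sub>R (cmod (g x))\<^sup>2)"
    using assms unfolding locally_L2_def set_integrable_def by auto
  have i1: "integrable lborel (\<lambda>x. indicator K x * (1::real))"
    using borel_integrable_compact[OF assms(2) continuous_on_const[of _ "1::real"]] by simp
  show ?thesis
    unfolding set_integrable_def
  proof (rule Bochner_Integration.integrable_bound[OF Bochner_Integration.integrable_add[OF i1 *]])
    have "t \<le> 1 + t\<^sup>2" for t :: real
      using sum_squares_bound[of t 1] by (simp add: power2_eq_square) (smt (verit) zero_le_square)
    then show "AE x in lborel. norm (indicator K x *\<^sub>R g x)
        \<le> norm (indicator K x * 1 + indicator K x *\<^sub>R (cmod (g x))\<^sup>2)"
      by (auto simp: indicator_def)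
  qed measurable
qed

lemma integrable_locally_L2_mult_test_function:
  assumes "locally_L2 g" "\<psi> \<in> test_functions"
  shows "integrable lborel (\<lambda>x. g x * \<psi> x)"
proof -
  let ?K = "closure {x. \<psi> x \<noteq> 0}"
  have K: "compact ?K" and c: "continuous_on UNIV \<psi>"
    using assms(2) smooth_continuous_on by (auto simp: test_functions_def)
  have [measurable]: "g \<in> borel_measurable borel" "\<psi> \<in> borel_measurable borel"
    using assms(1) c unfolding locally_L2_def by (auto intro: borel_measurable_continuous_onI)
  have "compact (\<psi> ` ?K)"
    by (rule compact_continuous_image[OF continuous_on_subset[OF c] K]) simp
  then obtain B where B: "\<And>x. x \<in> ?K \<Longrightarrow> cmod (\<psi> x) \<le> B"
    by (meson bounded_iff compact_imp_bounded imageI)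
  have *: "cmod (g x * \<psi> x) \<le> B * cmod (indicator ?K x *\<^sub>R g x)" for x
  proof (cases "\<psi> x = 0")
    case False
    then have "x \<in> ?K" by (intro subsetD[OF closure_subset]) simp
    with B show ?thesis by (auto simp: norm_mult mult.commute[of "cmod (g x)"] mult_right_mono)
  next
    case True
    show ?thesis
    proof (cases "x \<in> ?K")
      case True
      then have "0 \<le> B" using B norm_ge_zero order_trans by blast
      with \<open>\<psi> x = 0\<close> show ?thesis by simp
    qed (simp add: \<open>\<psi> x = 0\<close>)
  qed
  show ?thesis
  proof (rule Bochner_Integration.integrable_bound)
    show "integrable lborel (\<lambda>x. B * cmod (indicator ?K x *\<^sub>R g x))"
      using locally_L2_set_integrable[OF assms(1) K] unfolding set_integrable_def
      by (intro integrable_mult_right integrable_norm)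
    show "AE x in lborel. norm (g x * \<psi> x) \<le> norm (B * cmod (indicator ?K x *\<^sub>R g x))"
      using * by (intro always_eventually allI) (metis abs_ge_self order_trans real_norm_def)
  qed measurable
qed

lemma represented_by_unique:
  assumes g: "locally_L2 g1" "locally_L2 g2" and u: "represented_by u g1" "represented_by u g2"
  shows "AE x in lborel. g1 x = g2 x"
proof -
  have "AE x in lborel. g1 x - g2 x = 0"
  proof (rule AE_zero_if_orthogonal_to_test_functions)
    show "(\<lambda>x. g1 x - g2 x) \<in> borel_measurable lborel"
      using g by (auto simp: locally_L2_def)
    show "set_integrable lborel K (\<lambda>x. g1 x - g2 x)" if "compact K" for K
      using g that by (intro set_integral_diff locally_L2_set_integrable)
    fix \<psi> :: "real^'a \<Rightarrow> complex" assume \<psi>: "\<psi> \<in> test_functions"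
    then show "(LINT x|lborel. (g1 x - g2 x) * \<psi> x) = 0"
      using u g unfolding represented_by_def
      by (simp add: left_diff_distrib integrable_locally_L2_mult_test_function)
  qed
  then show ?thesis by simp
qed

section \<open>Fourier transforms of test functions\<close>

lemma bounded_range_compact_support:
  fixes f :: "real^'d::finite \<Rightarrow> 'b::real_normed_vector"
  assumes f: "continuous_on UNIV f" and supp: "bounded {x. f x \<noteq> 0}"
  shows "bounded (range f)"
proof -
  let ?K = "closure {x. f x \<noteq> 0}"
  have "range f \<subseteq> insert 0 (f ` ?K)"
    using closure_subset[of "{x. f x \<noteq> 0}"] by auto
  moreover have "compact (f ` ?K)"
    using supp by (intro compact_continuous_image continuous_on_subset[OF f]) auto
  ultimately show ?thesis
    by (meson bounded_insert bounded_subset compact_imp_bounded)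
qed

lemma test_function_bound:
  assumes "\<psi> \<in> test_functions"
  obtains B where "B \<ge> 0" "\<And>x. cmod (\<psi> x) \<le> B"
proof -
  have "bounded (range \<psi>)"
    by (intro bounded_range_compact_support smooth_continuous_on test_functionsD assms)
  then show ?thesis using that unfolding bounded_pos by (metis less_imp_le rangeI)
qed

lemma test_function_mult:
  "\<psi> \<in> test_functions \<Longrightarrow> smooth f \<Longrightarrow> (\<lambda>x. \<psi> x * f x) \<in> test_functions"
proof (rule test_functionsI)
  assume \<psi>: "\<psi> \<in> test_functions" and f: "smooth f"
  show "smooth (\<lambda>x. \<psi> x * f x)" by (rule smooth_mult[OF test_functionsD(1)[OF \<psi>] f])
  show "bounded {x. \<psi> x * f x \<noteq> 0}"
    by (rule bounded_subset[OF test_functionsD(2)[OF \<psi>]]) auto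
qed

lemma test_function_iter_partial:
  assumes "\<psi> \<in> test_functions" shows "iter_partial is \<psi> \<in> test_functions"
proof (induction "is")
  case (Cons i "is")
  let ?f = "iter_partial is \<psi>"
  let ?S = "closure {x. ?f x \<noteq> 0}"
  have "iter_partial [i] ?f x = 0" if "x \<notin> ?S" for x
  proof -
    have "(?f has_derivative (\<lambda>v. 0)) (at x)"
    proof (rule has_derivative_transform_within_open[of "\<lambda>x. 0" _ _ UNIV "- ?S"])
      show "0 = ?f y" if "y \<in> - ?S" for y
        using that closure_subset[of "{x. ?f x \<noteq> 0}"] by auto
    qed (use that in auto)
    from iter_partial_1_eq[OF this] show ?thesis .
  qed
  then have "{x. iter_partial [i] ?f x \<noteq> 0} \<subseteq> ?S" by blast
  moreover have "bounded ?S" using test_functionsD(2)[OF Cons] by (rule bounded_closure)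
  ultimately have "bounded {x. iter_partial [i] ?f x \<noteq> 0}" by (rule bounded_subset[rotated])
  moreover have "smooth (iter_partial [i] ?f)"
    by (intro smooth_iter_partial test_functionsD(1)[OF Cons])
  ultimately show ?case using test_functionsI[of "iter_partial [i] ?f"] by simp
qed (simp add: assms)

lemma test_function_affine:
  assumes "\<psi> \<in> test_functions" "h \<noteq> 0"
  shows "(\<lambda>x. \<psi> (h *\<^sub>R x + j)) \<in> test_functions"
proof (rule test_functionsI)
  show "smooth (\<lambda>x. \<psi> (h *\<^sub>R x + j))"
    by (rule iter_partial_affine(2)[OF test_functionsD(1)[OF assms(1)]])
  have "bounded ((\<lambda>y. (1 / h) *\<^sub>R (y + (- j))) ` {x. \<psi> x \<noteq> 0})"
    using bounded_scaling[OF bounded_translation[OF test_functionsD(2)[OF assms(1)], of "-j"], of "1/h"]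
    by (simp add: image_image add.commute)
  then show "bounded {x. \<psi> (h *\<^sub>R x + j) \<noteq> 0}"
    by (rule bounded_subset) (use assms(2) in \<open>force intro!: image_eqI\<close>)
qed

lemma locally_L2_1: "locally_L2 (\<lambda>x. 1)"
  unfolding locally_L2_def set_integrable_def
  using borel_integrable_compact[of _ "\<lambda>_. 1::real"] by auto

lemma integrable_test_function: "\<psi> \<in> test_functions \<Longrightarrow> integrable lborel \<psi>"
  using integrable_locally_L2_mult_test_function[OF locally_L2_1] by simp

lemma lborel_affine_cart:
  fixes t :: "real^'d::finite" and c :: real
  assumes c: "c > 0"
  shows "lborel = density (distr lborel borel (\<lambda>x. c *\<^sub>R x + t)) (\<lambda>_. ennreal (c ^ CARD('d)))"
  using lborel_affine[of c t] c by (simp add: add.commute ennreal_power)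

lemma integrable_lborel_affine:
  fixes f :: "real^'d::finite \<Rightarrow> 'a::{banach, second_countable_topology}"
  assumes c: "c > 0" and f: "integrable lborel f"
  shows "integrable lborel (\<lambda>x. f (c *\<^sub>R x + t))"
proof -
  have [measurable]: "f \<in> borel_measurable borel" using f by auto
  have "integrable (density (distr lborel borel (\<lambda>x. c *\<^sub>R x + t)) (\<lambda>_. ennreal (c ^ CARD('d)))) f"
    using f lborel_affine_cart[OF c, of t] by simp
  then have "integrable lborel (\<lambda>x. c ^ CARD('d) *\<^sub>R f (c *\<^sub>R x + t))" using c
    by (subst (asm) integrable_density) (simp_all add: integrable_distr_eq)
  then have "integrable lborel (\<lambda>x. inverse (c ^ CARD('d)) *\<^sub>R c ^ CARD('d) *\<^sub>R f (c *\<^sub>R x + t))"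
    by (rule integrable_scaleR_right)
  then show ?thesis using c by simp
qed

lemma integral_lborel_affine:
  fixes f :: "real^'d::finite \<Rightarrow> 'a::{banach, second_countable_topology}"
  assumes c: "c > 0" and f[measurable]: "f \<in> borel_measurable borel"
  shows "(LINT x|lborel. f x) = c ^ CARD('d) *\<^sub>R (LINT x|lborel. f (c *\<^sub>R x + t))"
proof -
  have "(LINT x|lborel. f x)
      = (LINT x|density (distr lborel borel (\<lambda>x. c *\<^sub>R x + t)) (\<lambda>_. ennreal (c ^ CARD('d))). f x)"
    using lborel_affine_cart[OF c, of t] by simp
  also have "\<dots> = c ^ CARD('d) *\<^sub>R (LINT x|lborel. f (c *\<^sub>R x + t))"
    using c by (subst integral_density) (simp_all add: integral_distr)
  finally show ?thesis .
qed

text \<open>Difference quotients of \<open>\<psi>\<close> have integral zero by translation invariance, and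
  they converge boundedly on a fixed ball to the partial derivative.\<close>

lemma integral_partial_eq_0:
  assumes \<psi>: "\<psi> \<in> test_functions"
  shows "(LINT x|lborel. iter_partial [i] \<psi> x) = 0"
proof -
  let ?e = "axis i (1::real)"
  define r where "r n = inverse (real (Suc n))" for n
  define D where "D n x = (\<psi> (1 *\<^sub>R x + r n *\<^sub>R ?e) - \<psi> x) / of_real (r n)" for n x
  have r: "0 < r n" "r n \<le> 1" for n by (auto simp: r_def field_simps)
  have r0: "r \<longlonglongrightarrow> 0" unfolding r_def by (rule LIMSEQ_inverse_real_of_nat)
  note sm = test_functionsD(1)[OF \<psi>]
  have [measurable]: "\<psi> \<in> borel_measurable borel" using sm by (rule smooth_borel_measurable)
  obtain B where B: "\<And>x. cmod (iter_partial [i] \<psi> x) \<le> B" "B \<ge> 0"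
    using test_function_bound[OF test_function_iter_partial[OF \<psi>, of "[i]"]] by metis
  obtain R where R: "\<And>x. \<psi> x \<noteq> 0 \<Longrightarrow> norm x \<le> R"
    using test_functionsD(2)[OF \<psi>] unfolding bounded_iff by auto
  have line: "((\<lambda>s. \<psi> (x + s *\<^sub>R ?e)) has_derivative (\<lambda>s. s *\<^sub>R iter_partial [i] \<psi> (x + t *\<^sub>R ?e))) (at t)" for x t
  proof -
    have "((\<lambda>s. x + s *\<^sub>R ?e) has_derivative (\<lambda>s. s *\<^sub>R ?e)) (at t)"
      by (auto intro!: derivative_eq_intros)
    from has_derivative_compose[OF this smooth_has_derivative[OF sm]]
    show ?thesis
      by (simp add: linear_scale[OF linear_frechet_derivative[OF smooth_differentiable[OF sm]]])
  qed
  have "(\<lambda>n. LINT x|lborel. D n x) \<longlonglongrightarrow> (LINT x|lborel. iter_partial [i] \<psi> x)"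
  proof (rule integral_dominated_convergence[where w="\<lambda>x. indicator (cball 0 (R + 1)) x *\<^sub>R B"])
    show "iter_partial [i] \<psi> \<in> borel_measurable lborel"
      using smooth_borel_measurable[OF smooth_iter_partial[OF sm, of "[i]"]] by simp
    show "D n \<in> borel_measurable lborel" for n unfolding D_def by measurable
    show "integrable lborel (\<lambda>x::real^'a. indicator (cball 0 (R + 1)) x *\<^sub>R B)"
      by (rule borel_integrable_compact) auto
    show "AE x in lborel. (\<lambda>n. D n x) \<longlonglongrightarrow> iter_partial [i] \<psi> x"
    proof (intro always_eventually allI)
      fix x
      have "((\<lambda>s. norm (\<psi> (x + s *\<^sub>R ?e) - \<psi> x - s *\<^sub>R iter_partial [i] \<psi> x) / norm s) \<longlongrightarrow> 0) (at 0)"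
        using line[of x 0] by (simp add: has_derivative_at del: iter_partial.simps)
      moreover have "filterlim r (at 0) sequentially"
        by (rule filterlim_atI[OF r0]) (use r in \<open>auto simp: less_imp_neq[symmetric]\<close>)
      ultimately have "(\<lambda>n. norm (\<psi> (x + r n *\<^sub>R ?e) - \<psi> x - r n *\<^sub>R iter_partial [i] \<psi> x) / norm (r n)) \<longlonglongrightarrow> 0"
        by (rule filterlim_compose)
      also have "(\<lambda>n. norm (\<psi> (x + r n *\<^sub>R ?e) - \<psi> x - r n *\<^sub>R iter_partial [i] \<psi> x) / norm (r n))
          = (\<lambda>n. norm (D n x - iter_partial [i] \<psi> x))"
      proof
        fix n
        have "D n x - iter_partial [i] \<psi> x
            = (\<psi> (x + r n *\<^sub>R ?e) - \<psi> x - r n *\<^sub>R iter_partial [i] \<psi> x) / of_real (r n)"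
          using r[of n] by (simp add: D_def diff_divide_distrib scaleR_conv_of_real del: iter_partial.simps)
        then show "norm (\<psi> (x + r n *\<^sub>R ?e) - \<psi> x - r n *\<^sub>R iter_partial [i] \<psi> x) / norm (r n)
            = norm (D n x - iter_partial [i] \<psi> x)"
          by (simp add: norm_divide del: iter_partial.simps)
      qed
      finally show "(\<lambda>n. D n x) \<longlonglongrightarrow> iter_partial [i] \<psi> x"
        by (rule LIM_zero_cancel[OF tendsto_norm_zero_cancel])
    qed
    have "norm (D n x) \<le> indicator (cball 0 (R + 1)) x *\<^sub>R B" for n x
    proof (cases "x \<in> cball 0 (R + 1)")
      case True
      have "norm (\<psi> (x + r n *\<^sub>R ?e) - \<psi> (x + 0 *\<^sub>R ?e)) \<le> B * norm (r n - 0)"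
      proof (rule differentiable_bound[where S=UNIV and f'="\<lambda>t s. s *\<^sub>R iter_partial [i] \<psi> (x + t *\<^sub>R ?e)"
            and f="\<lambda>s. \<psi> (x + s *\<^sub>R ?e)"])
        show "onorm (\<lambda>s. s *\<^sub>R iter_partial [i] \<psi> (x + t *\<^sub>R ?e)) \<le> B" for t :: real
          by (rule onorm_bound) (auto simp: B mult.commute[of B] mult_left_mono simp del: iter_partial.simps)
      qed (use line in \<open>auto simp del: iter_partial.simps\<close>)
      then show ?thesis using True r[of n]
        by (simp add: D_def norm_divide field_simps)
    next
      case False
      have "norm (r n *\<^sub>R ?e) \<le> 1" using r[of n] by simp
      then have "norm x \<le> norm (x + r n *\<^sub>R ?e) + 1"
        using norm_triangle_ineq4[of "x + r n *\<^sub>R ?e" "r n *\<^sub>R ?e"] by simp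
      then have "\<psi> (x + r n *\<^sub>R ?e) = 0 \<and> \<psi> x = 0"
        using R[of x] R[of "x + r n *\<^sub>R ?e"] False by force
      then show ?thesis using False by (simp add: D_def)
    qed
    then show "AE x in lborel. norm (D n x) \<le> indicator (cball 0 (R + 1)) x *\<^sub>R B" for n by simp
  qed
  moreover have "(LINT x|lborel. D n x) = 0" for n
  proof -
    have "(LINT x|lborel. \<psi> (1 *\<^sub>R x + r n *\<^sub>R ?e)) = (LINT x|lborel. \<psi> x)"
      by (subst integral_lborel_affine[of 1 \<psi> "r n *\<^sub>R ?e"]) simp_all
    then show ?thesis
      unfolding D_def using integrable_test_function[OF \<psi>] integrable_lborel_affine[of 1 \<psi>]
      by (simp del: scaleR_one)
  qed
  ultimately show ?thesis by (simp add: LIMSEQ_const_iff)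
qed

lemma integrable_mult_character:
  assumes "integrable lborel f"
  shows "integrable lborel (\<lambda>x. f x * exp (\<i> * of_real (\<omega> \<bullet> x)))"
    "integrable lborel (\<lambda>x. f x * exp (- \<i> * of_real (\<omega> \<bullet> x)))"
proof -
  have "integrable lborel (\<lambda>x. f x * exp (\<i> * of_real (\<omega> \<bullet> x)))" for \<omega>
    by (rule Bochner_Integration.integrable_bound[OF assms])
      (use assms in \<open>auto simp: norm_mult intro: borel_measurable_integrable\<close>)
  from this[of \<omega>] this[of "-\<omega>"]
  show "integrable lborel (\<lambda>x. f x * exp (\<i> * of_real (\<omega> \<bullet> x)))"
    "integrable lborel (\<lambda>x. f x * exp (- \<i> * of_real (\<omega> \<bullet> x)))" by auto
qed

lemma norm_fourier_le: "cmod (fourier f \<omega>) \<le> (LINT x|lborel. cmod (f x))"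
  unfolding fourier_def by (rule order_trans[OF integral_norm_bound]) (simp add: norm_mult)

text \<open>The function \<open>\<psi>\<close> times a character is a test function, so its partial derivative has integral zero; the product rule
  turns this into the usual exchange of derivatives and multiplication.\<close>

lemma fourier_partial:
  assumes \<psi>: "\<psi> \<in> test_functions"
  shows "fourier (iter_partial [i] \<psi>) \<omega> = \<i> * of_real (\<omega> $ i) * fourier \<psi> \<omega>"
proof -
  let ?e = "\<lambda>x. exp (\<i> * complex_of_real ((- \<omega>) \<bullet> x))"
  note e = smooth_character[of "- \<omega>"]
  have de: "iter_partial [i] ?e x = - \<i> * of_real (\<omega> $ i) * ?e x" for x
    using iter_partial_1_eq[OF has_derivative_character[of 1 "-\<omega>"], of i x]
    by (simp add: inner_axis del: iter_partial.simps)
  have eq: "iter_partial [i] (\<lambda>x. \<psi> x * ?e x) x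
      = - \<i> * of_real (\<omega> $ i) * (\<psi> x * ?e x) + iter_partial [i] \<psi> x * ?e x" for x
    unfolding iter_partial_1_mult[OF smooth_differentiable[OF test_functionsD(1)[OF \<psi>]]
      smooth_differentiable[OF e]] de
    by (simp add: algebra_simps del: iter_partial.simps)
  have "0 = (LINT x|lborel. iter_partial [i] (\<lambda>x. \<psi> x * ?e x) x)"
    by (rule integral_partial_eq_0[OF test_function_mult[OF \<psi> e], symmetric])
  also have "\<dots> = (LINT x|lborel. - \<i> * of_real (\<omega> $ i) * (\<psi> x * ?e x) + iter_partial [i] \<psi> x * ?e x)"
    by (simp only: eq)
  also have "\<dots>
     = - \<i> * of_real (\<omega> $ i) * (LINT x|lborel. \<psi> x * ?e x)
      + (LINT x|lborel. iter_partial [i] \<psi> x * ?e x)"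
    using integrable_mult_character(1)[OF integrable_test_function[OF \<psi>], of "-\<omega>"]
     integrable_mult_character(1)[OF integrable_test_function[OF test_function_iter_partial[OF \<psi>, of "[i]"]], of "-\<omega>"]
    by (subst Bochner_Integration.integral_add) (simp_all del: iter_partial.simps)
  finally show ?thesis unfolding fourier_def by (simp add: algebra_simps del: iter_partial.simps)
qed

text \<open>Differentiation under the integral: the second-order Taylor remainder of the character is at most
  \<open>(v \<bullet> x)\<^sup>2\<close>, so the remainder of the transform is at most \<open>\<bar>v\<bar>\<^sup>2\<close> times the second absolute moment of \<open>\<psi>\<close>.\<close>

lemma fourier_has_derivative:
  assumes \<psi>: "\<psi> \<in> test_functions"
  shows "(fourier \<psi> has_derivative
    (\<lambda>v. \<Sum>i\<in>UNIV. of_real (v $ i) * fourier (\<lambda>x. \<psi> x * (- \<i> * of_real (x $ i))) \<omega>)) (at \<omega>)"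
    (is "(_ has_derivative ?L) _")
proof (rule has_derivativeI_sandwich[where e=1])
  have test: "(\<lambda>x. \<psi> x * (- \<i> * of_real (x $ i))) \<in> test_functions" for i
    by (intro test_function_mult \<psi> smooth_mult smooth_const smooth_coordinate)
  have c: "continuous_on UNIV \<psi>" using \<psi> by (intro smooth_continuous_on test_functionsD)
  show "bounded_linear ?L"
    by (intro bounded_linear_sum bounded_linear_mult_left[THEN bounded_linear_compose]
        bounded_linear_of_real[THEN bounded_linear_compose] bounded_linear_vec_nth)
  let ?E = "\<lambda>x. exp (- \<i> * complex_of_real (\<omega> \<bullet> x))"
  have int2: "integrable lborel (\<lambda>x. cmod (\<psi> x * of_real (norm x ^ 2)))"
  proof -
    have "(\<lambda>x. \<psi> x * (\<Sum>i\<in>UNIV. of_real (x $ i) * of_real (x $ i))) \<in> test_functions"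
      by (intro test_function_mult \<psi> smooth_sum smooth_mult smooth_coordinate) simp
    moreover have "(\<Sum>i\<in>UNIV. of_real (x $ i) * of_real (x $ i)) = complex_of_real (norm x ^ 2)" for x :: "real^'a"
      by (simp add: power2_norm_eq_inner inner_vec_def)
    ultimately have "(\<lambda>x. \<psi> x * of_real (norm x ^ 2)) \<in> test_functions" by (simp only:)
    then show ?thesis by (intro integrable_norm integrable_test_function)
  qed
  show "norm (fourier \<psi> y - fourier \<psi> \<omega> - ?L (y - \<omega>)) / norm (y - \<omega>)
      \<le> (LINT x|lborel. cmod (\<psi> x * of_real (norm x ^ 2))) * norm (y - \<omega>)"
    if "y \<noteq> \<omega>" for y
  proof -
    define v where "v = y - \<omega>"
    have y: "y = \<omega> + v" by (simp add: v_def)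
    have L: "?L v = (LINT x|lborel. \<psi> x * (- \<i> * of_real (v \<bullet> x)) * ?E x)"
    proof -
      have "?L v = (\<Sum>i\<in>UNIV. LINT x|lborel. of_real (v $ i) * (\<psi> x * (- \<i> * of_real (x $ i)) * ?E x))"
        unfolding fourier_def by simp
      also have "\<dots> = (LINT x|lborel. (\<Sum>i\<in>UNIV. of_real (v $ i) * (\<psi> x * (- \<i> * of_real (x $ i)) * ?E x)))"
        by (rule Bochner_Integration.integral_sum[symmetric])
          (intro integrable_mult_right integrable_mult_character integrable_test_function test)
      also have "\<dots> = (LINT x|lborel. \<psi> x * (- \<i> * of_real (v \<bullet> x)) * ?E x)"
        by (simp add: inner_vec_def sum_distrib_left sum_distrib_right ac_simps sum_negf)
      finally show ?thesis .
    qed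
    have intL: "integrable lborel (\<lambda>x. \<psi> x * (- \<i> * of_real (v \<bullet> x)) * ?E x)"
    proof -
      have "integrable lborel (\<lambda>x. (\<Sum>i\<in>UNIV. of_real (v $ i) * (\<psi> x * (- \<i> * of_real (x $ i)) * ?E x)))"
        by (intro Bochner_Integration.integrable_sum integrable_mult_right integrable_mult_character integrable_test_function test)
      then show ?thesis
        by (simp add: inner_vec_def sum_distrib_left sum_distrib_right ac_simps sum_negf)
    qed
    note i1 = integrable_mult_character(2)[OF integrable_test_function[OF \<psi>]]
    have "fourier \<psi> y - fourier \<psi> \<omega> - ?L v
        = (LINT x|lborel. \<psi> x * exp (- \<i> * of_real (y \<bullet> x)) - \<psi> x * ?E x - \<psi> x * (- \<i> * of_real (v \<bullet> x)) * ?E x)"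
      unfolding L unfolding fourier_def using i1 intL by simp
    also have "norm \<dots> \<le> (LINT x|lborel. cmod (\<psi> x * of_real (norm x ^ 2)) * norm v ^ 2)"
    proof (rule Bochner_Integration.integral_norm_bound_integral)
      show "integrable lborel (\<lambda>x. \<psi> x * exp (- \<i> * of_real (y \<bullet> x)) - \<psi> x * ?E x - \<psi> x * (- \<i> * of_real (v \<bullet> x)) * ?E x)"
        using i1 intL by (intro Bochner_Integration.integrable_diff)
      show "integrable lborel (\<lambda>x. cmod (\<psi> x * of_real (norm x ^ 2)) * norm v ^ 2)"
        using int2 by (rule integrable_mult_left)
      fix x
      define \<theta> where "\<theta> = v \<bullet> x"
      have "\<psi> x * exp (- \<i> * of_real (y \<bullet> x)) - \<psi> x * ?E x - \<psi> x * (- \<i> * of_real (v \<bullet> x)) * ?E x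
          = \<psi> x * ?E x * (exp (- \<i> * \<theta>) - (1 + (- \<i> * \<theta>)))"
        unfolding y \<theta>_def by (simp add: inner_add_left algebra_simps exp_add[symmetric])
      also have "cmod \<dots> = cmod (\<psi> x) * cmod (exp (- \<i> * \<theta>) - (1 + (- \<i> * \<theta>)))"
        by (simp add: norm_mult)
      also have "\<dots> \<le> cmod (\<psi> x) * (norm v * norm x)\<^sup>2"
      proof (rule mult_left_mono)
        have "cmod (exp (- \<i> * \<theta>) - (1 + (- \<i> * \<theta>))) \<le> \<theta>\<^sup>2"
          using Taylor_exp[of "- \<i> * \<theta>" 1] by (simp add: norm_mult power2_eq_square)
        also have "\<dots> \<le> (norm v * norm x)\<^sup>2"
          unfolding \<theta>_def by (metis Cauchy_Schwarz_ineq2 abs_ge_zero power2_abs power_mono)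
        finally show "cmod (exp (- \<i> * \<theta>) - (1 + (- \<i> * \<theta>))) \<le> (norm v * norm x)\<^sup>2" .
      qed simp
      also have "\<dots> = cmod (\<psi> x * of_real (norm x ^ 2)) * norm v ^ 2"
        by (simp add: norm_mult norm_power power_mult_distrib ac_simps)
      finally show "norm (\<psi> x * exp (- \<i> * of_real (y \<bullet> x)) - \<psi> x * ?E x - \<psi> x * (- \<i> * of_real (v \<bullet> x)) * ?E x)
          \<le> cmod (\<psi> x * of_real (norm x ^ 2)) * norm v ^ 2" .
    qed
    also have "\<dots> = (LINT x|lborel. cmod (\<psi> x * of_real (norm x ^ 2))) * norm v ^ 2"
      by (rule integral_mult_left_zero)
    finally show ?thesis
      using that unfolding v_def[symmetric] by (simp add: v_def divide_le_eq power2_eq_square ac_simps)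
  qed
  have "((\<lambda>y. (LINT x|lborel. cmod (\<psi> x * of_real (norm x ^ 2))) * norm (y - \<omega>))
      \<longlongrightarrow> (LINT x|lborel. cmod (\<psi> x * of_real (norm x ^ 2))) * norm (\<omega> - \<omega>)) (at \<omega>)"
    by (intro tendsto_intros)
  then show "((\<lambda>y. (LINT x|lborel. cmod (\<psi> x * of_real (norm x ^ 2))) * norm (y - \<omega>)) \<longlongrightarrow> 0) (at \<omega>)"
    by simp
qed simp

lemma partial_fourier:
  assumes "\<psi> \<in> test_functions"
  shows "iter_partial [i] (fourier \<psi>) = fourier (\<lambda>x. \<psi> x * (- \<i> * of_real (x $ i)))"
  by (rule ext, subst iter_partial_1_eq[OF fourier_has_derivative[OF assms]])
    (simp add: axis_def if_distrib[of complex_of_real] if_distrib[of "\<lambda>x. x * _"] cong: if_cong)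

lemma iter_partial_fourier:
  assumes "\<psi> \<in> test_functions"
  shows "\<exists>\<eta>\<in>test_functions. iter_partial is (fourier \<psi>) = fourier \<eta>"
proof (induction "is")
  case (Cons i "is")
  then obtain \<eta> where \<eta>: "\<eta> \<in> test_functions" "iter_partial is (fourier \<psi>) = fourier \<eta>" by auto
  have "(\<lambda>x. \<eta> x * (- \<i> * of_real (x $ i))) \<in> test_functions"
    by (intro test_function_mult \<eta> smooth_mult smooth_const smooth_coordinate)
  moreover have "iter_partial (i # is) (fourier \<psi>) = iter_partial [i] (fourier \<eta>)"
    using \<eta>(2) by simp
  ultimately show ?case using partial_fourier[OF \<eta>(1)] by metis
qed (use assms in auto)

lemma smooth_fourier:
  assumes "\<psi> \<in> test_functions" shows "smooth (fourier \<psi>)"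
  unfolding smooth_def
proof (intro allI)
  fix "is" \<omega>
  obtain \<eta> where \<eta>: "\<eta> \<in> test_functions" "iter_partial is (fourier \<psi>) = fourier \<eta>"
    using iter_partial_fourier[OF assms] by blast
  show "iter_partial is (fourier \<psi>) differentiable (at \<omega>)"
    unfolding \<eta>(2) differentiable_def using fourier_has_derivative[OF \<eta>(1)] by blast
qed

text \<open>Each further factor \<open>1 + \<bar>\<omega>\<bar>\<close> is dominated by 1 plus the sum of the \<open>\<bar>\<omega>\<^sub>i\<bar>\<close>, and \<open>\<omega>\<^sub>i\<close> times the transform of
  \<open>\<psi>\<close> is, up to a unimodular constant, the transform of the test function \<open>\<partial>\<^sub>i \<psi>\<close>.\<close>

lemma fourier_decay:
  assumes "\<psi> \<in> test_functions"
  shows "\<exists>B. \<forall>\<omega>. (1 + norm \<omega>) ^ N * cmod (fourier \<psi> \<omega>) \<le> B"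
  using assms
proof (induction N arbitrary: \<psi>)
  case 0
  then show ?case using norm_fourier_le[of \<psi>] by auto
next
  case (Suc N)
  obtain B where B: "\<And>\<omega>. (1 + norm \<omega>) ^ N * cmod (fourier \<psi> \<omega>) \<le> B"
    using Suc by blast
  have "\<forall>i. \<exists>B. \<forall>\<omega>. (1 + norm \<omega>) ^ N * cmod (fourier (iter_partial [i] \<psi>) \<omega>) \<le> B"
    using Suc.IH[OF test_function_iter_partial[OF Suc.prems]] by blast
  then obtain C where C: "\<And>i \<omega>. (1 + norm \<omega>) ^ N * cmod (fourier (iter_partial [i] \<psi>) \<omega>) \<le> C i"
    by metis
  have "(1 + norm \<omega>) ^ Suc N * cmod (fourier \<psi> \<omega>) \<le> B + (\<Sum>i\<in>UNIV. C i)" for \<omega>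
  proof -
    have "(1 + norm \<omega>) ^ Suc N * cmod (fourier \<psi> \<omega>)
        = (1 + norm \<omega>) ^ N * cmod (fourier \<psi> \<omega>) + norm \<omega> * ((1 + norm \<omega>) ^ N * cmod (fourier \<psi> \<omega>))"
      by (simp add: algebra_simps)
    also have "norm \<omega> * ((1 + norm \<omega>) ^ N * cmod (fourier \<psi> \<omega>))
        \<le> (\<Sum>i\<in>UNIV. \<bar>\<omega> $ i\<bar>) * ((1 + norm \<omega>) ^ N * cmod (fourier \<psi> \<omega>))"
      by (intro mult_right_mono norm_le_l1_cart) auto
    also have "\<dots> = (\<Sum>i\<in>UNIV. (1 + norm \<omega>) ^ N * cmod (fourier (iter_partial [i] \<psi>) \<omega>))"
      by (simp add: fourier_partial[OF Suc.prems] norm_mult sum_distrib_left sum_distrib_right ac_simps del: iter_partial.simps)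
    also have "\<dots> \<le> (\<Sum>i\<in>UNIV. C i)" by (intro sum_mono C)
    finally show ?thesis using B[of \<omega>] by linarith
  qed
  then show ?case by blast
qed

lemma fourier_schwartz: 
  assumes "\<psi> \<in> test_functions" shows "fourier \<psi> \<in> schwartz_space"
  unfolding schwartz_space_def
proof (intro CollectI conjI allI)
  show "smooth (fourier \<psi>)" by (rule smooth_fourier[OF assms])
  fix N "is"
  obtain \<eta> where \<eta>: "\<eta> \<in> test_functions" "iter_partial is (fourier \<psi>) = fourier \<eta>"
    using iter_partial_fourier[OF assms] by metis
  from fourier_decay[OF \<eta>(1), of N] obtain B
    where B: "\<And>\<omega>. (1 + norm \<omega>) ^ N * cmod (fourier \<eta> \<omega>) \<le> B" by blast
  show "bounded (range (\<lambda>x. of_real ((1 + norm x) ^ N) * iter_partial is (fourier \<psi>) x))"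
    unfolding bounded_iff \<eta>(2)
  proof (intro exI[of _ B] ballI, elim rangeE)
    fix y x assume "y = of_real ((1 + norm x) ^ N) * fourier \<eta> x"
    then have "norm y = \<bar>(1 + norm x) ^ N\<bar> * cmod (fourier \<eta> x)"
      by (simp only: norm_mult norm_of_real)
    then show "norm y \<le> B" using B[of x] by simp
  qed
qed

lemma test_function_schwartz:
  assumes "\<psi> \<in> test_functions" shows "\<psi> \<in> schwartz_space"
  unfolding schwartz_space_def
proof (intro CollectI conjI allI)
  show "smooth \<psi>" by (rule test_functionsD(1)[OF assms])
  fix N "is"
  note t = test_function_iter_partial[OF assms, of "is"]
  show "bounded (range (\<lambda>x. of_real ((1 + norm x) ^ N) * iter_partial is \<psi> x))"
  proof (rule bounded_range_compact_support)
    show "continuous_on UNIV (\<lambda>x. of_real ((1 + norm x) ^ N) * iter_partial is \<psi> x)"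
      by (intro continuous_intros smooth_continuous_on test_functionsD(1)[OF t])
    show "bounded {x. of_real ((1 + norm x) ^ N) * iter_partial is \<psi> x \<noteq> 0}"
      by (rule bounded_subset[OF test_functionsD(2)[OF t]]) auto
  qed
qed

section \<open>Seminorms and integrals of Schwartz functions\<close>

text \<open>A point with \<open>n \<le> \<bar>x\<bar> \<le> n + 1\<close> lies in the cube of side \<open>2 (n + 1)\<close>, whose volume is of order
  \<open>(n + 1)\<^sup>d\<close>; the exponent \<open>d + 2\<close> leaves the convergent series of \<open>1 / (n + 1)\<^sup>2\<close>.\<close>

lemma integrable_inverse_power_norm:
  "integrable lborel (\<lambda>x::real^'d::finite. inverse ((1 + norm x) ^ (CARD('d) + 2)))"
proof (rule integrableI_nonneg)
  let ?N = "CARD('d) + 2"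
  define Q where "Q n = cbox (vec (- real (Suc n))) (vec (real (Suc n)) :: real^'d)" for n
  define a where "a n = inverse (real (Suc n) ^ ?N)" for n
  have a: "a n \<ge> 0" for n by (simp add: a_def)
  have Q: "emeasure lborel (Q n) = ennreal (2 ^ CARD('d) * real (Suc n) ^ CARD('d))" for n
  proof -
    have "cbox (vec (- real (Suc n))) (vec (real (Suc n)) :: real^'d) \<noteq> {}"
      by (auto simp: interval_ne_empty_cart)
    from content_cbox_cart[OF this] have "measure lborel (Q n) = (real (Suc n) + real (Suc n)) ^ CARD('d)"
      unfolding Q_def by simp
    also have "\<dots> = 2 ^ CARD('d) * real (Suc n) ^ CARD('d)"
      by (simp flip: power_mult_distrib mult_2)
    finally show ?thesis
      using emeasure_lborel_cbox_finite[of "vec (- real (Suc n))" "vec (real (Suc n)) :: real^'d"]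
        emeasure_eq_ennreal_measure[of lborel "Q n"] unfolding Q_def by simp
  qed
  have "ennreal (inverse ((1 + norm x) ^ ?N)) \<le> (\<Sum>n. ennreal (a n) * indicator (Q n) x)" for x :: "real^'d"
  proof -
    define n where "n = nat \<lfloor>norm x\<rfloor>"
    have n: "real n \<le> norm x" "norm x \<le> real (Suc n)"
    proof -
      have "real n = real_of_int \<lfloor>norm x\<rfloor>" by (simp add: n_def)
      then show "real n \<le> norm x" "norm x \<le> real (Suc n)" by linarith+
    qed
    have "x \<in> Q n"
      unfolding Q_def mem_box_cart using component_le_norm_cart[of x] n(2)
      by (auto simp: abs_le_iff intro: order_trans) (smt (verit) of_nat_Suc)
    moreover have "inverse ((1 + norm x) ^ ?N) \<le> a n"
      unfolding a_def using n by (intro le_imp_inverse_le power_mono) auto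
    ultimately have "ennreal (inverse ((1 + norm x) ^ ?N)) \<le> ennreal (a n) * indicator (Q n) x"
      by (simp add: ennreal_leI)
    also have "\<dots> \<le> (\<Sum>n. ennreal (a n) * indicator (Q n) x)"
    proof -
      define f where "f m = ennreal (a m) * indicator (Q m) x" for m
      have "f n \<le> suminf f"
        using sum_le_suminf[OF summableI, of "{n}" f] by simp
      then show ?thesis by (simp only: f_def[abs_def])
    qed
    finally show ?thesis .
  qed
  then have "(\<integral>\<^sup>+x. ennreal (inverse ((1 + norm x) ^ ?N)) \<partial>(lborel :: (real^'d) measure))
      \<le> (\<integral>\<^sup>+x. (\<Sum>n. ennreal (a n) * indicator (Q n) x) \<partial>(lborel :: (real^'d) measure))"
    by (intro nn_integral_mono)
  also have "\<dots> = (\<Sum>n. \<integral>\<^sup>+x. ennreal (a n) * indicator (Q n) x \<partial>(lborel :: (real^'d) measure))"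
    by (rule nn_integral_suminf) (simp add: Q_def)
  also have "\<dots> = (\<Sum>n. ennreal (2 ^ CARD('d) * inverse (real (Suc n) ^ 2)))"
  proof (rule suminf_cong)
    fix n
    have "(\<integral>\<^sup>+x. ennreal (a n) * indicator (Q n) x \<partial>lborel) = ennreal (a n) * emeasure lborel (Q n)"
      by (rule nn_integral_cmult_indicator) (simp add: Q_def)
    also have "\<dots> = ennreal (a n * (2 ^ CARD('d) * real (Suc n) ^ CARD('d)))"
      unfolding Q by (rule ennreal_mult[symmetric]) (auto simp: a_def)
    also have "a n * (2 ^ CARD('d) * real (Suc n) ^ CARD('d)) = 2 ^ CARD('d) * inverse (real (Suc n) ^ 2)"
      unfolding a_def power_add by (simp add: field_simps del: of_nat_Suc)
    finally show "(\<integral>\<^sup>+x. ennreal (a n) * indicator (Q n) x \<partial>lborel)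
        = ennreal (2 ^ CARD('d) * inverse (real (Suc n) ^ 2))" .
  qed
  also have "\<dots> < \<infinity>"
  proof -
    have "summable (\<lambda>n. inverse (real (Suc n) ^ 2))"
      using inverse_power_summable[OF order_refl, where 'a=real] by (subst summable_Suc_iff) simp
    then have "summable (\<lambda>n. 2 ^ CARD('d) * inverse (real (Suc n) ^ 2))"
      by (rule summable_mult)
    then have "(\<Sum>n. ennreal (2 ^ CARD('d) * inverse (real (Suc n) ^ 2))) \<noteq> top"
      by (rule ennreal_suminf_neq_top) simp
    then show ?thesis unfolding infinity_ennreal_def less_top .
  qed
  finally show "(\<integral>\<^sup>+x. ennreal (inverse ((1 + norm x) ^ ?N)) \<partial>(lborel :: (real^'d) measure)) < \<infinity>" .
qed auto

lemma schwartz_smooth: "\<psi> \<in> schwartz_space \<Longrightarrow> smooth \<psi>"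
  by (simp add: schwartz_space_def)

lemma finite_lists_length_le_UNIV: "finite {is :: 'd::finite list. length is \<le> N}"
  using finite_lists_length_le[of "UNIV :: 'd set" N] by simp

text \<open>The seminorm is a supremum of reals, so it can only be used once this set is known to be
  bounded. There are finitely many lists of length at most \<open>N\<close>, and each of them contributes a bounded set.\<close>

lemma schwartz_seminorm_bdd:
  assumes "\<psi> \<in> schwartz_space"
  shows "bdd_above ((\<lambda>(is, x). (1 + norm x) ^ N * cmod (iter_partial is \<psi> x)) ` ({is. length is \<le> N} \<times> UNIV))"
proof -
  have "\<forall>is. \<exists>B. \<forall>x. (1 + norm x) ^ N * cmod (iter_partial is \<psi> x) \<le> B"
  proof
    fix "is"
    have "bounded (range (\<lambda>x. of_real ((1 + norm x) ^ N) * iter_partial is \<psi> x))"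
      using assms unfolding schwartz_space_def by blast
    then obtain B where "\<And>x. cmod (of_real ((1 + norm x) ^ N) * iter_partial is \<psi> x) \<le> B"
      unfolding bounded_iff by blast
    then show "\<exists>B. \<forall>x. (1 + norm x) ^ N * cmod (iter_partial is \<psi> x) \<le> B"
      unfolding norm_mult norm_of_real by auto
  qed
  then obtain B where B: "\<And>is x. (1 + norm x) ^ N * cmod (iter_partial is \<psi> x) \<le> B is"
    by metis
  show ?thesis
  proof (rule bdd_aboveI2[where M="Max (B ` {is. length is \<le> N})"], clarify)
    fix "is" :: "'a list" and x assume "length is \<le> N"
    then have "B is \<le> Max (B ` {is. length is \<le> N})"
      by (intro Max_ge finite_imageI finite_lists_length_le_UNIV) auto
    with B[of x "is"] show "(1 + norm x) ^ N * cmod (iter_partial is \<psi> x) \<le> Max (B ` {is. length is \<le> N})"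
      by linarith
  qed
qed

lemma schwartz_seminorm_upper:
  assumes "\<psi> \<in> schwartz_space" "length is \<le> N"
  shows "(1 + norm x) ^ N * cmod (iter_partial is \<psi> x) \<le> schwartz_seminorm N \<psi>"
  using cSUP_upper[OF _ schwartz_seminorm_bdd[OF assms(1), of N], of "(is, x)"] assms(2)
  by (simp add: schwartz_seminorm_def)

lemma schwartz_seminorm_least:
  assumes "\<And>is x. length is \<le> N \<Longrightarrow> (1 + norm x) ^ N * cmod (iter_partial is \<psi> x) \<le> B"
  shows "schwartz_seminorm N \<psi> \<le> B"
  unfolding schwartz_seminorm_def
proof (rule cSUP_least)
  have "([], 0) \<in> {is. length is \<le> N} \<times> (UNIV :: (real^'a) set)" by simp
  then show "{is. length is \<le> N} \<times> (UNIV :: (real^'a) set) \<noteq> {}" by blast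
qed (use assms in auto)

lemma schwartz_seminorm_nonneg:
  assumes "\<psi> \<in> schwartz_space" shows "0 \<le> schwartz_seminorm N \<psi>"
  using schwartz_seminorm_upper[OF assms, of "[]" N 0] by simp (meson norm_ge_zero order_trans)

lemma schwartz_seminorm_mono:
  assumes "\<psi> \<in> schwartz_space" "N \<le> M"
  shows "schwartz_seminorm N \<psi> \<le> schwartz_seminorm M \<psi>"
proof (rule schwartz_seminorm_least)
  fix "is" :: "'a list" and x :: "real^'a" assume "length is \<le> N"
  have "(1 + norm x) ^ N * cmod (iter_partial is \<psi> x) \<le> (1 + norm x) ^ M * cmod (iter_partial is \<psi> x)"
    using assms(2) by (intro mult_right_mono power_increasing) auto
  also have "\<dots> \<le> schwartz_seminorm M \<psi>"
    using \<open>length is \<le> N\<close> assms by (intro schwartz_seminorm_upper) auto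
  finally show "(1 + norm x) ^ N * cmod (iter_partial is \<psi> x) \<le> schwartz_seminorm M \<psi>" .
qed

lemma iter_partial_add:
  assumes "smooth f" "smooth g"
  shows "iter_partial is (\<lambda>x. f x + g x) = (\<lambda>x. iter_partial is f x + iter_partial is g x)"
proof (induction "is")
  case (Cons i "is")
  have "iter_partial (i # is) (\<lambda>x. f x + g x)
      = iter_partial [i] (\<lambda>x. iter_partial is f x + iter_partial is g x)"
    using Cons by simp
  also have "\<dots> = (\<lambda>x. iter_partial [i] (iter_partial is f) x + iter_partial [i] (iter_partial is g) x)"
    using assms by (intro ext iter_partial_1_add smooth_differentiable smooth_iter_partial)
  finally show ?case by simp
qed simp

lemma iter_partial_cmult:
  assumes "smooth f"
  shows "iter_partial is (\<lambda>x. c * f x) = (\<lambda>x. c * iter_partial is f x)"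
proof (induction "is")
  case (Cons i "is")
  have "iter_partial (i # is) (\<lambda>x. c * f x) = iter_partial [i] (\<lambda>x. c * iter_partial is f x)"
    using Cons by simp
  also have "\<dots> = (\<lambda>x. c * iter_partial [i] (iter_partial is f) x)"
  proof
    fix x
    have "(iter_partial is f has_derivative frechet_derivative (iter_partial is f) (at x)) (at x)"
      by (intro smooth_has_derivative smooth_iter_partial assms)
    from iter_partial_1_eq[OF has_derivative_mult_right[OF this, of c]]
    show "iter_partial [i] (\<lambda>x. c * iter_partial is f x) x = c * iter_partial [i] (iter_partial is f) x"
      by simp
  qed
  finally show ?case by simp
qed simp

lemma schwartz_add:
  assumes "\<psi> \<in> schwartz_space" "\<eta> \<in> schwartz_space"
  shows "(\<lambda>x. \<psi> x + \<eta> x) \<in> schwartz_space"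
proof -
  have "bounded (range (\<lambda>x. of_real ((1 + norm x) ^ N) * iter_partial is \<psi> x
      + of_real ((1 + norm x) ^ N) * iter_partial is \<eta> x))" for N "is"
    using assms by (intro bounded_plus_comp) (auto simp: schwartz_space_def)
  then show ?thesis
    using assms unfolding schwartz_space_def
    by (simp add: smooth_add iter_partial_add distrib_left)
qed

lemma schwartz_cmult:
  assumes "\<psi> \<in> schwartz_space"
  shows "(\<lambda>x. c * \<psi> x) \<in> schwartz_space"
proof -
  have "bounded ((\<lambda>z. c * z) ` range (\<lambda>x. of_real ((1 + norm x) ^ N) * iter_partial is \<psi> x))" for N "is"
    by (rule bounded_linear_image[OF _ bounded_linear_mult_right])
      (use assms in \<open>unfold schwartz_space_def, blast\<close>)
  then show ?thesis
    using assms unfolding schwartz_space_def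
    by (simp add: smooth_mult[OF smooth_const] iter_partial_cmult image_image mult.left_commute)
qed

lemma schwartz_integrable:
  fixes \<psi> :: "real^'d::finite \<Rightarrow> complex"
  assumes \<psi>: "\<psi> \<in> schwartz_space"
  shows "integrable lborel \<psi>"
    and "(LINT x|lborel. cmod (\<psi> x)) \<le> (LINT x|lborel. inverse ((1 + norm (x :: real^'d)) ^ (CARD('d) + 2)))
      * schwartz_seminorm (CARD('d) + 2) \<psi>"
proof -
  let ?N = "CARD('d) + 2"
  let ?w = "\<lambda>x::real^'d. inverse ((1 + norm x) ^ ?N) * schwartz_seminorm ?N \<psi>"
  have le: "cmod (\<psi> x) \<le> ?w x" for x
  proof -
    have "(1 + norm x) ^ ?N * cmod (\<psi> x) \<le> schwartz_seminorm ?N \<psi>"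
      using schwartz_seminorm_upper[OF \<psi>, of "[]" ?N x] by simp
    moreover have "(1 + norm x) ^ ?N > 0"
      by (intro zero_less_power add_pos_nonneg) auto
    ultimately show ?thesis
      by (simp add: field_simps)
  qed
  have w: "integrable lborel ?w"
    by (intro integrable_mult_left integrable_inverse_power_norm)
  have [measurable]: "\<psi> \<in> borel_measurable borel"
    by (intro smooth_borel_measurable schwartz_smooth \<psi>)
  show i: "integrable lborel \<psi>"
    by (rule Bochner_Integration.integrable_bound[OF w])
      (auto intro!: always_eventually order_trans[OF le] abs_ge_self)
  have "(LINT x|lborel. cmod (\<psi> x)) \<le> (LINT x|lborel. ?w x)"
    by (intro integral_mono integrable_norm i w le)
  then show "(LINT x|lborel. cmod (\<psi> x)) \<le> (LINT x|lborel. inverse ((1 + norm (x :: real^'d)) ^ ?N))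
      * schwartz_seminorm ?N \<psi>"
    by simp
qed

section \<open>Fourier inversion on test functions\<close>

lemma norm_integral_character_le:
  assumes "integrable lborel f"
  shows "norm (LINT x|lborel. f x * exp (\<i> * of_real (\<omega> \<bullet> x))) \<le> (LINT x|lborel. cmod (f x))"
  by (rule order_trans[OF integral_norm_bound]) (simp add: norm_mult)

text \<open>For \<open>s = - 1\<close> this is the multiplication formula for the Fourier transform; for \<open>s = 1\<close> it
  yields the Plancherel identity.\<close>

lemma Fubini_character:
  fixes f g :: "real^'d::finite \<Rightarrow> complex"
  assumes f: "integrable lborel f" and g: "integrable lborel g"
  shows "(LINT y|lborel. (LINT x|lborel. f x * exp (\<i> * of_real (s * (y \<bullet> x)))) * g y)
    = (LINT x|lborel. f x * (LINT y|lborel. g y * exp (\<i> * of_real (s * (x \<bullet> y)))))"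
proof -
  have [measurable]: "f \<in> borel_measurable borel" "g \<in> borel_measurable borel"
    using f g by auto
  let ?F = "\<lambda>x y. f x * (g y * exp (\<i> * of_real (s * (x \<bullet> y))))"
  have ig: "integrable lborel (\<lambda>y. g y * exp (\<i> * of_real (s * (x \<bullet> y))))" for x
    using integrable_mult_character(1)[OF g, of "s *\<^sub>R x"] by simp
  have int: "integrable (lborel \<Otimes>\<^sub>M lborel) (\<lambda>(x, y). ?F x y)"
  proof (rule lborel_pair.Fubini_integrable)
    show "(\<lambda>(x, y). ?F x y) \<in> borel_measurable (lborel \<Otimes>\<^sub>M lborel)" by measurable
    show "integrable lborel (\<lambda>x. LINT y|lborel. norm (case (x, y) of (x, y) \<Rightarrow> ?F x y))"
      using f by (simp add: norm_mult)
    show "AE x in lborel. integrable lborel (\<lambda>y. case (x, y) of (x, y) \<Rightarrow> ?F x y)"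
      using ig by simp
  qed
  have "(LINT y|lborel. (LINT x|lborel. f x * exp (\<i> * of_real (s * (y \<bullet> x)))) * g y)
      = (LINT y|lborel. (LINT x|lborel. ?F x y))"
    by (subst integral_mult_left_zero[symmetric]) (simp add: ac_simps inner_commute)
  also have "\<dots> = (LINT x|lborel. (LINT y|lborel. ?F x y))"
    by (rule lborel_pair.Fubini_integral[OF int])
  finally show ?thesis by simp
qed

lemma AE_zero_continuous:
  fixes f :: "real^'d::finite \<Rightarrow> 'b::real_normed_vector"
  assumes f: "continuous_on UNIV f" and ae: "AE x in lborel. f x = 0"
  shows "f x = 0"
proof (rule ccontr)
  assume "f x \<noteq> 0"
  have op: "open {x. f x \<noteq> 0}"
    using f by (intro open_Collect_neq) auto
  have "{x. f x \<noteq> 0} \<in> null_sets lborel"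
    using ae op AE_iff_null[of lborel "\<lambda>x. f x = 0"] by simp
  then have "negligible {x. f x \<noteq> 0}"
    using null_sets_completionI negligible_iff_null_sets by blast
  with op \<open>f x \<noteq> 0\<close> show False using open_not_negligible by blast
qed

text \<open>Compare the two sides of the multiplication formula for \<open>\<psi>\<close> and \<open>G(r \<cdot>)\<close>. After the change
  of variables \<open>y \<mapsto> r y\<close>, it reads \<open>\<integral> F\<psi>(x) G(r x) dx = \<integral> FG(y) \<psi>(r y) dy\<close>, and \<open>r \<rightarrow> 0\<close> gives the claim.\<close>

lemma fourier_concentration:
  fixes \<psi> G :: "real^'d::finite \<Rightarrow> complex"
  assumes \<psi>: "\<psi> \<in> test_functions" and G: "G \<in> test_functions"
  shows "(LINT x|lborel. fourier \<psi> x) * G 0 = \<psi> 0 * (LINT y|lborel. fourier G y)"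
proof -
  define r where "r n = inverse (real (Suc n))" for n
  have r: "r n > 0" for n by (simp add: r_def)
  have r0: "r \<longlonglongrightarrow> 0" unfolding r_def by (rule LIMSEQ_inverse_real_of_nat)
  have cont: "continuous_on UNIV \<psi>" "continuous_on UNIV G"
    by (intro smooth_continuous_on test_functionsD \<psi> G)+
  have int: "integrable lborel (fourier \<psi>)" "integrable lborel (fourier G)"
    by (intro schwartz_integrable(1) fourier_schwartz \<psi> G)+
  have meas[measurable]: "\<psi> \<in> borel_measurable borel" "G \<in> borel_measurable borel"
     "fourier \<psi> \<in> borel_measurable borel" "fourier G \<in> borel_measurable borel"
    by (intro smooth_borel_measurable test_functionsD \<psi> G smooth_fourier)+
  have lim: "(\<lambda>n. LINT x|lborel. f x * g (r n *\<^sub>R x)) \<longlonglongrightarrow> (LINT x|lborel. f x * g 0)"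
    if f: "integrable lborel f" and g: "g \<in> test_functions" for f g :: "real^'d \<Rightarrow> complex"
  proof -
    obtain B where B: "\<And>x. cmod (g x) \<le> B" "B \<ge> 0" using test_function_bound[OF g] by metis
    have [measurable]: "f \<in> borel_measurable borel" "g \<in> borel_measurable borel"
      using f by (auto intro!: smooth_borel_measurable test_functionsD g)
    show ?thesis
    proof (rule integral_dominated_convergence[where w="\<lambda>x. cmod (f x) * B"])
      show "integrable lborel (\<lambda>x. cmod (f x) * B)" using f by simp
      have "(\<lambda>n. f x * g (r n *\<^sub>R x)) \<longlonglongrightarrow> f x * g (0 *\<^sub>R x)" for x
        by (intro tendsto_intros isCont_tendsto_compose[where g=g] r0
          continuous_on_interior[OF smooth_continuous_on[OF test_functionsD(1)[OF g], of UNIV]]) simp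
      then show "AE x in lborel. (\<lambda>n. f x * g (r n *\<^sub>R x)) \<longlonglongrightarrow> f x * g 0" by simp
      show "AE x in lborel. norm (f x * g (r n *\<^sub>R x)) \<le> cmod (f x) * B" for n
        using B by (auto simp: norm_mult intro!: mult_left_mono)
    qed measurable
  qed
  have "(LINT x|lborel. fourier \<psi> x * G (r n *\<^sub>R x)) = (LINT y|lborel. fourier G y * \<psi> (r n *\<^sub>R y))" for n
  proof -
    have Gr: "(\<lambda>x. G (r n *\<^sub>R x)) \<in> test_functions"
      using test_function_affine[OF G, of "r n" 0] r[of n] by simp
    have dual: "r n ^ CARD('d) *\<^sub>R fourier (\<lambda>x. G (r n *\<^sub>R x)) (r n *\<^sub>R y) = fourier G y" for y
      unfolding fourier_def
      using integral_lborel_affine[OF r, of "\<lambda>x. G x * exp (- \<i> * of_real (y \<bullet> x))" n 0] by simp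
    have "(LINT x|lborel. fourier \<psi> x * G (r n *\<^sub>R x))
        = (LINT y|lborel. \<psi> y * fourier (\<lambda>x. G (r n *\<^sub>R x)) y)"
      using Fubini_character[OF integrable_test_function[OF \<psi>] integrable_test_function[OF Gr], of "-1"]
      unfolding fourier_def by simp
    also have "\<dots> = r n ^ CARD('d) *\<^sub>R (LINT y|lborel. \<psi> (r n *\<^sub>R y) * fourier (\<lambda>x. G (r n *\<^sub>R x)) (r n *\<^sub>R y))"
      using integral_lborel_affine[OF r, of "\<lambda>y. \<psi> y * fourier (\<lambda>x. G (r n *\<^sub>R x)) y" n 0]
        smooth_borel_measurable[OF smooth_fourier[OF Gr]] by simp
    also have "\<dots> = (LINT y|lborel. \<psi> (r n *\<^sub>R y) * (r n ^ CARD('d) *\<^sub>R fourier (\<lambda>x. G (r n *\<^sub>R x)) (r n *\<^sub>R y)))"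
      by (simp flip: integral_scaleR_right)
    also have "\<dots> = (LINT y|lborel. fourier G y * \<psi> (r n *\<^sub>R y))"
      by (simp only: dual mult.commute)
    finally show ?thesis .
  qed
  with lim[OF int(1) G] lim[OF int(2) \<psi>] show ?thesis
    by (simp add: LIMSEQ_unique mult.commute)
qed

text \<open>By \<open>fourier_concentration\<close> the integral of the transform of \<open>\<psi>\<close> is proportional to \<open>\<psi> 0\<close>, and
  translating \<open>\<psi>\<close> gives the formula at every point. The constant is \<open>(2\<pi>)\<^sup>d\<close>, but only that it is nonzero
  matters below, which avoids computing any particular Fourier transform.\<close>

lemma fourier_inversion:
  obtains c where "c \<noteq> 0"
    "\<And>\<psi> \<omega>. \<psi> \<in> test_functions \<Longrightarrow>
      (LINT x|lborel. fourier \<psi> x * exp (\<i> * of_real (\<omega> \<bullet> x))) = c * \<psi> (\<omega> :: real^'d::finite)"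
proof -
  define b where "b = box_bump 1 (vec (-1)) (vec 1 :: real^'d)"
  define B where "B = (\<lambda>x. complex_of_real (b x))"
  have B: "B \<in> test_functions" unfolding B_def b_def by (rule box_bump_test_function)
  have b_nonneg: "b x \<ge> 0" for x unfolding b_def by (rule box_bump_bounds)
  have b0: "b 0 > 0" unfolding b_def by (rule box_bump_pos) (auto simp: mem_box_cart)
  define c where "c = (LINT y|lborel. fourier B y) / B 0"
  have at0: "(LINT x|lborel. fourier \<psi> x) = c * \<psi> 0" if "\<psi> \<in> test_functions" for \<psi> :: "real^'d \<Rightarrow> complex"
    using fourier_concentration[OF that B] b0 by (simp add: c_def B_def field_simps)
  have inv: "(LINT x|lborel. fourier \<psi> x * exp (\<i> * of_real (\<omega> \<bullet> x))) = c * \<psi> \<omega>"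
    if \<psi>: "\<psi> \<in> test_functions" for \<psi> :: "real^'d \<Rightarrow> complex" and \<omega>
  proof -
    have [measurable]: "\<psi> \<in> borel_measurable borel"
      by (intro smooth_borel_measurable test_functionsD \<psi>)
    have "fourier (\<lambda>y. \<psi> (1 *\<^sub>R y + \<omega>)) x = fourier \<psi> x * exp (\<i> * of_real (\<omega> \<bullet> x))" for x
      unfolding fourier_def
      using integral_lborel_affine[of 1 "\<lambda>y. \<psi> y * exp (- \<i> * of_real (x \<bullet> y))" \<omega>]
      by (simp add: inner_add_right inner_commute[of \<omega>] algebra_simps exp_add[symmetric]
          flip: integral_mult_right_zero)
    then show ?thesis
      using at0[OF test_function_affine[OF \<psi>, of 1 \<omega>]] by simp
  qed
  \<comment> \<open>Were \<open>c = 0\<close>, the Plancherel identity would give the bump a vanishing transform, hence a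
    vanishing integral.\<close>
  have "c \<noteq> 0"
  proof
    assume c: "c = 0"
    have iF: "integrable lborel (fourier B)"
      by (intro schwartz_integrable(1) fourier_schwartz B)
    obtain M where M: "\<And>x. cmod (fourier B x) \<le> M" using norm_fourier_le by metis
    have conj: "(LINT y|lborel. B y * exp (\<i> * of_real (1 * (x \<bullet> y)))) = cnj (fourier B x)" for x
    proof -
      have e: "B y * exp (\<i> * of_real (1 * (x \<bullet> y))) = cnj (B y * exp (- \<i> * of_real (x \<bullet> y)))" for y
        by (simp add: B_def exp_cnj)
      show ?thesis unfolding fourier_def e by (rule Bochner_Integration.integral_cnj)
    qed
    have "(LINT x|lborel. fourier B x * (LINT y|lborel. B y * exp (\<i> * of_real (1 * (x \<bullet> y))))) = 0"
      unfolding Fubini_character[OF iF integrable_test_function[OF B], symmetric]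
      using inv[OF B] c by simp
    then have "(LINT x|lborel. complex_of_real (cmod (fourier B x) ^ 2)) = 0"
      by (simp only: conj complex_norm_square)
    then have "(LINT x|lborel. cmod (fourier B x) ^ 2) = 0"
      by (simp only: integral_complex_of_real of_real_eq_0_iff)
    moreover have "integrable lborel (\<lambda>x. cmod (fourier B x) ^ 2)"
    proof (rule Bochner_Integration.integrable_bound[OF integrable_mult_right[OF iF[THEN integrable_norm], of M]])
      show "AE x in lborel. norm (cmod (fourier B x) ^ 2) \<le> norm (M * cmod (fourier B x))"
        using M order_trans[OF norm_ge_zero M] by (auto simp: power2_eq_square intro!: mult_right_mono)
    qed (use iF in auto)
    ultimately have "AE x in lborel. fourier B x = 0"
      by (subst (asm) integral_nonneg_eq_0_iff_AE) auto
    then have "fourier B 0 = 0"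
      by (intro AE_zero_continuous smooth_continuous_on smooth_fourier B)
    then have "(LINT x|lborel. b x) = 0"
      unfolding fourier_def B_def by simp
    moreover have "integrable lborel b"
      using integrable_Re[OF integrable_test_function[OF B]] unfolding B_def by simp
    ultimately have "AE x in lborel. b x = 0"
      using b_nonneg by (subst (asm) integral_nonneg_eq_0_iff_AE) auto
    then have "AE x in lborel. B x = 0" by (simp add: B_def)
    then have "B 0 = 0"
      by (intro AE_zero_continuous smooth_continuous_on test_functionsD B)
    with b0 show False by (simp add: B_def)
  qed
  with inv that show ?thesis by blast
qed

section \<open>Sobolev spaces as weighted square-integrable functions\<close>

definition energy_density :: "real \<Rightarrow> (real^'d::finite \<Rightarrow> complex) \<Rightarrow> real^'d \<Rightarrow> real" where
  "energy_density s g \<omega> = (1 + norm \<omega>) powr (2 * s) * (cmod (g \<omega>))\<^sup>2"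

lemma energy_density_nonneg: "0 \<le> energy_density s g \<omega>"
  by (simp add: energy_density_def)

lemma energy_density_measurable [measurable (raw)]:
  assumes [measurable]: "g \<in> borel_measurable borel"
  shows "energy_density s g \<in> borel_measurable borel"
  unfolding energy_density_def[abs_def] by measurable

lemma locally_L2_measurable: "locally_L2 g \<Longrightarrow> g \<in> borel_measurable borel"
  by (simp add: locally_L2_def)

lemma sobolev_spaceD:
  assumes "u \<in> sobolev_space s"
  shows "u \<in> tempered_distributions" "locally_L2 (fourier_fun u)"
    "represented_by (fourier_dist u) (fourier_fun u)"
    "integrable lborel (energy_density s (fourier_fun u))"
proof -
  show "u \<in> tempered_distributions" "integrable lborel (energy_density s (fourier_fun u))"
    using assms by (auto simp: sobolev_space_def energy_density_def[abs_def])
  have "\<exists>g. locally_L2 g \<and> represented_by (fourier_dist u) g"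
    using assms by (simp add: sobolev_space_def)
  from someI_ex[OF this]
  show "locally_L2 (fourier_fun u)" "represented_by (fourier_dist u) (fourier_fun u)"
    unfolding fourier_fun_def by auto
qed

lemma fourier_fun_AE_eq:
  assumes "locally_L2 g" "represented_by (fourier_dist u) g"
  shows "AE \<omega> in lborel. fourier_fun u \<omega> = g \<omega>" "locally_L2 (fourier_fun u)"
proof -
  have "\<exists>g. locally_L2 g \<and> represented_by (fourier_dist u) g" using assms by blast
  from someI_ex[OF this]
  have *: "locally_L2 (fourier_fun u)" "represented_by (fourier_dist u) (fourier_fun u)"
    unfolding fourier_fun_def by auto
  show "AE \<omega> in lborel. fourier_fun u \<omega> = g \<omega>"
    by (rule represented_by_unique[OF *(1) assms(1) *(2) assms(2)])
  show "locally_L2 (fourier_fun u)" by (rule *(1))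
qed

text \<open>Membership can be checked on any representing function, although \<open>fourier_fun\<close> is chosen by Hilbert choice: two
  representing functions agree almost everywhere.\<close>

lemma sobolev_spaceI:
  assumes u: "u \<in> tempered_distributions" and g: "locally_L2 g" "represented_by (fourier_dist u) g"
    and int: "integrable lborel (energy_density s g)"
  shows "u \<in> sobolev_space s"
proof -
  note ae = fourier_fun_AE_eq[OF g]
  have "integrable lborel (energy_density s (fourier_fun u))"
  proof (rule integrable_cong_AE_imp[OF int])
    show "energy_density s (fourier_fun u) \<in> borel_measurable lborel"
      using locally_L2_measurable[OF ae(2)] by measurable
    show "AE \<omega> in lborel. energy_density s g \<omega> = energy_density s (fourier_fun u) \<omega>"
      using ae(1) by eventually_elim (simp add: energy_density_def)
  qed
  then show ?thesis
    using u g by (auto simp: sobolev_space_def energy_density_def[abs_def])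
qed

lemma sobolev_norm_sq:
  "(sobolev_norm s u)\<^sup>2 = (LINT \<omega>|lborel. energy_density s (fourier_fun u) \<omega>)"
  unfolding sobolev_norm_def energy_density_def by (rule real_sqrt_pow2) simp

lemma sobolev_norm_nonneg: "0 \<le> sobolev_norm s u"
  by (simp add: sobolev_norm_def)

lemma sobolev_norm_le_if_density_le:
  assumes u: "u \<in> sobolev_space s" and v: "v \<in> sobolev_space t" and "B \<ge> 0"
    and le: "AE \<omega> in lborel. energy_density s (fourier_fun u) \<omega> \<le> B\<^sup>2 * energy_density t (fourier_fun v) \<omega>"
  shows "sobolev_norm s u \<le> B * sobolev_norm t v"
proof -
  have "(sobolev_norm s u)\<^sup>2 \<le> (LINT \<omega>|lborel. B\<^sup>2 * energy_density t (fourier_fun v) \<omega>)"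
    unfolding sobolev_norm_sq
    by (rule integral_mono_AE[OF sobolev_spaceD(4)[OF u] integrable_mult_right[OF sobolev_spaceD(4)[OF v]] le])
  also have "\<dots> = (B * sobolev_norm t v)\<^sup>2"
    by (simp add: power_mult_distrib sobolev_norm_sq)
  finally show ?thesis
    using assms(3) by (rule power2_le_imp_le[OF _ mult_nonneg_nonneg[OF _ sobolev_norm_nonneg]])
qed

lemma energy_density_mono: "t \<le> s \<Longrightarrow> energy_density t g \<omega> \<le> energy_density s g \<omega>"
  unfolding energy_density_def by (intro mult_right_mono powr_mono) auto

lemma sobolev_space_mono:
  assumes "t \<le> s" and u: "u \<in> sobolev_space s"
  shows "u \<in> sobolev_space t" "sobolev_norm t u \<le> sobolev_norm s u"
proof -
  note D = sobolev_spaceD[OF u]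
  show t: "u \<in> sobolev_space t"
  proof (rule sobolev_spaceI[OF D(1-3)])
    show "integrable lborel (energy_density t (fourier_fun u))"
      by (rule Bochner_Integration.integrable_bound[OF D(4)])
        (use locally_L2_measurable[OF D(2)] in \<open>auto simp: energy_density_nonneg energy_density_mono[OF assms(1)]\<close>)
  qed
  show "sobolev_norm t u \<le> sobolev_norm s u"
    using sobolev_norm_le_if_density_le[OF t u, of 1] by (simp add: energy_density_mono[OF assms(1)])
qed

lemma tempered_lincomb:
  assumes u: "u \<in> tempered_distributions" and v: "v \<in> tempered_distributions"
  shows "(\<lambda>\<psi>. a * u \<psi> + b * v \<psi>) \<in> tempered_distributions"
proof -
  obtain C N where C: "\<forall>\<psi>\<in>schwartz_space. cmod (u \<psi>) \<le> C * schwartz_seminorm N \<psi>"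
    using u unfolding tempered_distributions_def by blast
  obtain D M where D: "\<forall>\<psi>\<in>schwartz_space. cmod (v \<psi>) \<le> D * schwartz_seminorm M \<psi>"
    using v unfolding tempered_distributions_def by blast
  have "cmod (a * u \<psi> + b * v \<psi>) \<le> (cmod a * \<bar>C\<bar> + cmod b * \<bar>D\<bar>) * schwartz_seminorm (max N M) \<psi>"
    if \<psi>: "\<psi> \<in> schwartz_space" for \<psi>
  proof -
    let ?S = "schwartz_seminorm (max N M) \<psi>"
    have "cmod (u \<psi>) \<le> \<bar>C\<bar> * ?S"
      using C \<psi> schwartz_seminorm_mono[OF \<psi>, of N "max N M"] schwartz_seminorm_nonneg[OF \<psi>, of N]
      by (meson abs_ge_self abs_ge_zero max.cobounded1 mult_mono order_trans)
    moreover have "cmod (v \<psi>) \<le> \<bar>D\<bar> * ?S"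
      using D \<psi> schwartz_seminorm_mono[OF \<psi>, of M "max N M"] schwartz_seminorm_nonneg[OF \<psi>, of M]
      by (meson abs_ge_self abs_ge_zero max.cobounded2 mult_mono order_trans)
    ultimately have "cmod a * cmod (u \<psi>) + cmod b * cmod (v \<psi>) \<le> cmod a * (\<bar>C\<bar> * ?S) + cmod b * (\<bar>D\<bar> * ?S)"
      by (intro add_mono mult_left_mono) auto
    then show ?thesis
      using norm_triangle_ineq[of "a * u \<psi>" "b * v \<psi>"] by (simp add: norm_mult algebra_simps)
  qed
  moreover have "\<forall>\<psi>. \<psi> \<notin> schwartz_space \<longrightarrow> a * u \<psi> + b * v \<psi> = 0"
    using u v by (simp add: tempered_distributions_def)
  moreover have "\<forall>\<psi>\<in>schwartz_space. \<forall>\<eta>\<in>schwartz_space. a * u (\<lambda>x. \<psi> x + \<eta> x) + b * v (\<lambda>x. \<psi> x + \<eta> x)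
      = (a * u \<psi> + b * v \<psi>) + (a * u \<eta> + b * v \<eta>)"
    using u v by (simp add: tempered_distributions_def algebra_simps)
  moreover have "\<forall>\<psi>\<in>schwartz_space. \<forall>c. a * u (\<lambda>x. c * \<psi> x) + b * v (\<lambda>x. c * \<psi> x)
      = c * (a * u \<psi> + b * v \<psi>)"
    using u v by (simp add: tempered_distributions_def algebra_simps)
  ultimately show ?thesis unfolding tempered_distributions_def by blast
qed

lemma cmod_lincomb_sq:
  "(cmod (a * z + b * w))\<^sup>2 \<le> 2 * (cmod a)\<^sup>2 * (cmod z)\<^sup>2 + 2 * (cmod b)\<^sup>2 * (cmod w)\<^sup>2"
proof -
  have "(cmod (a * z + b * w))\<^sup>2 \<le> (cmod a * cmod z + cmod b * cmod w)\<^sup>2"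
    by (metis norm_ge_zero norm_mult norm_triangle_ineq power_mono)
  also have "\<dots> \<le> 2 * (cmod a * cmod z)\<^sup>2 + 2 * (cmod b * cmod w)\<^sup>2"
    using sum_squares_bound[of "cmod a * cmod z" "cmod b * cmod w"] by (simp add: power2_sum)
  finally show ?thesis by (simp add: power_mult_distrib)
qed

lemma energy_density_lincomb:
  "energy_density s (\<lambda>\<omega>. a * f \<omega> + b * g \<omega>) \<omega>
    \<le> 2 * (cmod a)\<^sup>2 * energy_density s f \<omega> + 2 * (cmod b)\<^sup>2 * energy_density s g \<omega>"
  using mult_left_mono[OF cmod_lincomb_sq[of a "f \<omega>" b "g \<omega>"], of "(1 + norm \<omega>) powr (2 * s)"]
  by (simp add: energy_density_def algebra_simps)

lemma locally_L2_lincomb: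
  assumes f: "locally_L2 f" and g: "locally_L2 g"
  shows "locally_L2 (\<lambda>\<omega>. a * f \<omega> + b * g \<omega>)"
proof -
  have [measurable]: "f \<in> borel_measurable borel" "g \<in> borel_measurable borel"
    using f g by (auto intro: locally_L2_measurable)
  have "set_integrable lborel K (\<lambda>x. (cmod (a * f x + b * g x))\<^sup>2)" if K: "compact K" for K
  proof -
    have [measurable]: "K \<in> sets borel" using K by (rule borel_compact)
    have "integrable lborel (\<lambda>x. 2 * (cmod a)\<^sup>2 * (indicator K x *\<^sub>R (cmod (f x))\<^sup>2)
        + 2 * (cmod b)\<^sup>2 * (indicator K x *\<^sub>R (cmod (g x))\<^sup>2))"
      using f g K unfolding locally_L2_def set_integrable_def
      by (intro Bochner_Integration.integrable_add integrable_mult_right) auto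
    then show ?thesis
      unfolding set_integrable_def
    proof (rule Bochner_Integration.integrable_bound)
      show "AE x in lborel. norm (indicator K x *\<^sub>R (cmod (a * f x + b * g x))\<^sup>2)
          \<le> norm (2 * (cmod a)\<^sup>2 * (indicator K x *\<^sub>R (cmod (f x))\<^sup>2)
            + 2 * (cmod b)\<^sup>2 * (indicator K x *\<^sub>R (cmod (g x))\<^sup>2))"
        by (intro always_eventually allI) (auto simp: indicator_def intro: order_trans[OF cmod_lincomb_sq])
    qed measurable
  qed
  then show ?thesis by (simp add: locally_L2_def)
qed

lemma sobolev_lincomb:
  assumes u: "u \<in> sobolev_space s" and v: "v \<in> sobolev_space s"
  shows "(\<lambda>\<psi>. a * u \<psi> + b * v \<psi>) \<in> sobolev_space s"
    and "AE \<omega> in lborel. fourier_fun (\<lambda>\<psi>. a * u \<psi> + b * v \<psi>) \<omega> = a * fourier_fun u \<omega> + b * fourier_fun v \<omega>"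
proof -
  note U = sobolev_spaceD[OF u] and V = sobolev_spaceD[OF v]
  let ?w = "\<lambda>\<psi>. a * u \<psi> + b * v \<psi>" and ?g = "\<lambda>\<omega>. a * fourier_fun u \<omega> + b * fourier_fun v \<omega>"
  have L: "locally_L2 ?g" by (rule locally_L2_lincomb[OF U(2) V(2)])
  have R: "represented_by (fourier_dist ?w) ?g"
    unfolding represented_by_def
  proof
    fix \<psi> :: "real^'a \<Rightarrow> complex" assume \<psi>: "\<psi> \<in> test_functions"
    have "fourier_dist ?w \<psi> = a * fourier_dist u \<psi> + b * fourier_dist v \<psi>"
      by (simp add: fourier_dist_def)
    also have "\<dots> = a * (LINT x|lborel. fourier_fun u x * \<psi> x) + b * (LINT x|lborel. fourier_fun v x * \<psi> x)"
      using U(3) V(3) \<psi> by (simp add: represented_by_def)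
    also have "\<dots> = (LINT x|lborel. a * (fourier_fun u x * \<psi> x) + b * (fourier_fun v x * \<psi> x))"
      using integrable_locally_L2_mult_test_function[OF U(2) \<psi>]
        integrable_locally_L2_mult_test_function[OF V(2) \<psi>] by simp
    finally show "fourier_dist ?w \<psi> = (LINT x|lborel. ?g x * \<psi> x)"
      by (simp add: algebra_simps)
  qed
  have I: "integrable lborel (energy_density s ?g)"
  proof (rule Bochner_Integration.integrable_bound)
    show "integrable lborel (\<lambda>\<omega>. 2 * (cmod a)\<^sup>2 * energy_density s (fourier_fun u) \<omega>
        + 2 * (cmod b)\<^sup>2 * energy_density s (fourier_fun v) \<omega>)"
      by (intro Bochner_Integration.integrable_add integrable_mult_right U V)
    show "energy_density s ?g \<in> borel_measurable lborel"
      using locally_L2_measurable[OF L] by measurable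
    show "AE \<omega> in lborel. norm (energy_density s ?g \<omega>) \<le> norm (2 * (cmod a)\<^sup>2 * energy_density s (fourier_fun u) \<omega>
        + 2 * (cmod b)\<^sup>2 * energy_density s (fourier_fun v) \<omega>)"
      by (intro always_eventually allI)
        (use energy_density_lincomb[of s a "fourier_fun u" b "fourier_fun v"] energy_density_nonneg[of s ?g]
          in \<open>auto intro!: order_trans[OF _ abs_ge_self]\<close>)
  qed
  show "?w \<in> sobolev_space s"
    by (rule sobolev_spaceI[OF tempered_lincomb[OF U(1) V(1)] L R I])
  show "AE \<omega> in lborel. fourier_fun ?w \<omega> = ?g \<omega>"
    by (rule fourier_fun_AE_eq(1)[OF L R])
qed

lemma sobolev_zero: "(\<lambda>\<psi>. 0) \<in> sobolev_space s"
proof (rule sobolev_spaceI)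
  show "(\<lambda>\<psi>. 0) \<in> tempered_distributions"
    unfolding tempered_distributions_def by (auto intro!: exI[of _ 0])
  show "locally_L2 (\<lambda>x. 0)" by (simp add: locally_L2_def set_integrable_def)
  show "represented_by (fourier_dist (\<lambda>\<psi>. 0)) (\<lambda>x. 0)" by (simp add: represented_by_def fourier_dist_def)
  show "integrable lborel (energy_density s (\<lambda>x. 0))" by (simp add: energy_density_def[abs_def])
qed

text \<open>A substitute for the triangle inequality: the contraction factor in the final iteration is small enough
  to absorb the factor 2.\<close>

lemma sobolev_norm_add_sq:
  assumes u: "u \<in> sobolev_space s" and v: "v \<in> sobolev_space s"
  shows "(sobolev_norm s (\<lambda>\<psi>. u \<psi> + v \<psi>))\<^sup>2 \<le> 2 * (sobolev_norm s u)\<^sup>2 + 2 * (sobolev_norm s v)\<^sup>2"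
proof -
  note w = sobolev_lincomb[OF u v, of 1 1, unfolded mult_1]
  note U = sobolev_spaceD[OF u] and V = sobolev_spaceD[OF v]
  have "(sobolev_norm s (\<lambda>\<psi>. u \<psi> + v \<psi>))\<^sup>2 \<le> (LINT \<omega>|lborel. 2 * energy_density s (fourier_fun u) \<omega>
      + 2 * energy_density s (fourier_fun v) \<omega>)"
    unfolding sobolev_norm_sq
  proof (rule integral_mono_AE)
    show "AE \<omega> in lborel. energy_density s (fourier_fun (\<lambda>\<psi>. u \<psi> + v \<psi>)) \<omega>
        \<le> 2 * energy_density s (fourier_fun u) \<omega> + 2 * energy_density s (fourier_fun v) \<omega>"
      using w(2)
    proof eventually_elim
      case (elim \<omega>)
      show ?case
        using energy_density_lincomb[of s 1 "fourier_fun u" 1 "fourier_fun v" \<omega>] elim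
        by (simp add: energy_density_def)
    qed
  qed (intro Bochner_Integration.integrable_add integrable_mult_right sobolev_spaceD(4)[OF w(1)] U V)+
  also have "\<dots> = 2 * (sobolev_norm s u)\<^sup>2 + 2 * (sobolev_norm s v)\<^sup>2"
    unfolding sobolev_norm_sq using U(4) V(4) by simp
  finally show ?thesis .
qed

lemma sobolev_diff:
  assumes u: "u \<in> sobolev_space s" and v: "v \<in> sobolev_space s"
  shows "u - v \<in> sobolev_space s"
    and "AE \<omega> in lborel. fourier_fun (u - v) \<omega> = fourier_fun u \<omega> - fourier_fun v \<omega>"
proof -
  have eq: "u - v = (\<lambda>\<psi>. 1 * u \<psi> + (-1) * v \<psi>)" by auto
  show "u - v \<in> sobolev_space s"
    "AE \<omega> in lborel. fourier_fun (u - v) \<omega> = fourier_fun u \<omega> - fourier_fun v \<omega>"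
    using sobolev_lincomb[OF u v, of 1 "-1", folded eq] by simp_all
qed

section \<open>Translates and dilates\<close>

text \<open>Translation is the case \<open>h = 1\<close> and dilation the case \<open>j = 0\<close>, so that one computation covers
  both.\<close>

definition affine_dist :: "complex \<Rightarrow> real \<Rightarrow> real^'d \<Rightarrow> 'd::finite functional \<Rightarrow> 'd functional" where
  "affine_dist a h j u = (\<lambda>\<psi>. a * u (\<lambda>x. \<psi> (h *\<^sub>R x + j)))"

lemma schwartz_affine_bound:
  assumes \<psi>: "\<psi> \<in> schwartz_space" and h: "h > 0" and N: "length is \<le> N"
  shows "(1 + norm x) ^ N * cmod (iter_partial is (\<lambda>x. \<psi> (h *\<^sub>R x + j)) x)
    \<le> ((1 + (1 + norm j) / h) * (1 + h)) ^ N * schwartz_seminorm N \<psi>"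
proof -
  let ?y = "h *\<^sub>R x + j"
  have "h * norm x = norm (?y - j)" using h by simp
  also have "\<dots> \<le> norm ?y + norm j" by (rule norm_triangle_ineq4)
  finally have "norm x \<le> (norm ?y + norm j) / h" using h by (simp add: field_simps)
  also have "1 + \<dots> \<le> (1 + (1 + norm j) / h) * (1 + norm ?y)"
    using h by (simp add: field_simps)
  finally have x: "1 + norm x \<le> (1 + (1 + norm j) / h) * (1 + norm ?y)" by simp
  have "h ^ length is \<le> (1 + h) ^ length is" using h by (intro power_mono) auto
  also have "\<dots> \<le> (1 + h) ^ N" using h N by (intro power_increasing) auto
  finally have hN: "h ^ length is \<le> (1 + h) ^ N" .
  have "(1 + norm x) ^ N * cmod (iter_partial is (\<lambda>x. \<psi> (h *\<^sub>R x + j)) x)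
      = (1 + norm x) ^ N * (h ^ length is * cmod (iter_partial is \<psi> ?y))"
    using h by (simp add: iter_partial_affine(1)[OF schwartz_smooth[OF \<psi>]] norm_mult norm_power)
  also have "\<dots> \<le> ((1 + (1 + norm j) / h) * (1 + norm ?y)) ^ N * ((1 + h) ^ N * cmod (iter_partial is \<psi> ?y))"
    using h x hN by (intro mult_mono power_mono mult_right_mono) auto
  also have "\<dots> = ((1 + (1 + norm j) / h) * (1 + h)) ^ N * ((1 + norm ?y) ^ N * cmod (iter_partial is \<psi> ?y))"
    by (simp add: power_mult_distrib ac_simps)
  also have "\<dots> \<le> ((1 + (1 + norm j) / h) * (1 + h)) ^ N * schwartz_seminorm N \<psi>"
    using h by (intro mult_left_mono schwartz_seminorm_upper[OF \<psi> N]) auto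
  finally show ?thesis .
qed

lemma schwartz_affine:
  assumes \<psi>: "\<psi> \<in> schwartz_space" and h: "h > 0"
  shows "(\<lambda>x. \<psi> (h *\<^sub>R x + j)) \<in> schwartz_space"
    and "schwartz_seminorm N (\<lambda>x. \<psi> (h *\<^sub>R x + j))
      \<le> ((1 + (1 + norm j) / h) * (1 + h)) ^ N * schwartz_seminorm N \<psi>"
proof -
  show "schwartz_seminorm N (\<lambda>x. \<psi> (h *\<^sub>R x + j))
      \<le> ((1 + (1 + norm j) / h) * (1 + h)) ^ N * schwartz_seminorm N \<psi>"
    by (intro schwartz_seminorm_least schwartz_affine_bound \<psi> h)
  show "(\<lambda>x. \<psi> (h *\<^sub>R x + j)) \<in> schwartz_space"
    unfolding schwartz_space_def
  proof (intro CollectI conjI allI)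
    show "smooth (\<lambda>x. \<psi> (h *\<^sub>R x + j))"
      by (intro iter_partial_affine schwartz_smooth \<psi>)
    fix N and "is" :: "'a list"
    \<comment> \<open>The seminorm of index \<open>M\<close> controls only derivatives of order at most \<open>M\<close>, hence the enlarged index.\<close>
    let ?f = "\<lambda>x. \<psi> (h *\<^sub>R x + j)" and ?M = "N + length is"
    show "bounded (range (\<lambda>x. of_real ((1 + norm x) ^ N) * iter_partial is ?f x))"
      unfolding bounded_iff
    proof (intro exI ballI, elim rangeE)
      fix z x assume z: "z = of_real ((1 + norm x) ^ N) * iter_partial is ?f x"
      have "norm z = \<bar>(1 + norm x) ^ N\<bar> * cmod (iter_partial is ?f x)"
        unfolding z by (simp only: norm_mult norm_of_real)
      also have "\<dots> \<le> (1 + norm x) ^ ?M * cmod (iter_partial is ?f x)"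
        by (auto intro!: mult_right_mono power_increasing)
      also have "\<dots> \<le> ((1 + (1 + norm j) / h) * (1 + h)) ^ ?M * schwartz_seminorm ?M \<psi>"
        by (intro schwartz_affine_bound \<psi> h) simp
      finally show "norm z \<le> ((1 + (1 + norm j) / h) * (1 + h)) ^ ?M * schwartz_seminorm ?M \<psi>" .
    qed
  qed
qed

lemma tempered_affine:
  assumes u: "u \<in> tempered_distributions" and h: "h > 0"
  shows "affine_dist a h j u \<in> tempered_distributions"
proof -
  note S = schwartz_affine(1)[OF _ h, of _ j]
  obtain C N where C: "\<forall>\<psi>\<in>schwartz_space. cmod (u \<psi>) \<le> C * schwartz_seminorm N \<psi>"
    using u unfolding tempered_distributions_def by blast
  let ?K = "((1 + (1 + norm j) / h) * (1 + h)) ^ N"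
  have "cmod (affine_dist a h j u \<psi>) \<le> (cmod a * \<bar>C\<bar> * ?K) * schwartz_seminorm N \<psi>"
    if \<psi>: "\<psi> \<in> schwartz_space" for \<psi>
  proof -
    let ?f = "\<lambda>x. \<psi> (h *\<^sub>R x + j)"
    have "cmod (u ?f) \<le> C * schwartz_seminorm N ?f" using C S[OF \<psi>] by blast
    also have "\<dots> \<le> \<bar>C\<bar> * (?K * schwartz_seminorm N \<psi>)"
      by (intro mult_mono schwartz_affine(2) \<psi> h) (auto intro: schwartz_seminorm_nonneg S \<psi>)
    finally have "cmod a * cmod (u ?f) \<le> cmod a * (\<bar>C\<bar> * (?K * schwartz_seminorm N \<psi>))"
      by (rule mult_left_mono) simp
    then show ?thesis by (simp add: affine_dist_def norm_mult ac_simps)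
  qed
  moreover have "affine_dist a h j u \<psi> = 0" if "\<psi> \<notin> schwartz_space" for \<psi>
  proof -
    have "(\<lambda>x. \<psi> (h *\<^sub>R x + j)) \<notin> schwartz_space"
    proof
      assume "(\<lambda>x. \<psi> (h *\<^sub>R x + j)) \<in> schwartz_space"
      from schwartz_affine(1)[OF this, of "1 / h" "- (1 / h) *\<^sub>R j"] h that show False
        by (simp add: scaleR_diff_right)
    qed
    with u show ?thesis by (simp add: affine_dist_def tempered_distributions_def)
  qed
  moreover have "affine_dist a h j u (\<lambda>x. \<psi> x + \<eta> x) = affine_dist a h j u \<psi> + affine_dist a h j u \<eta>"
    if "\<psi> \<in> schwartz_space" "\<eta> \<in> schwartz_space" for \<psi> \<eta>
    using u S that by (simp add: affine_dist_def tempered_distributions_def distrib_left)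
  moreover have "affine_dist a h j u (\<lambda>x. c * \<psi> x) = c * affine_dist a h j u \<psi>"
    if "\<psi> \<in> schwartz_space" for \<psi> c
    using u S that by (simp add: affine_dist_def tempered_distributions_def)
  ultimately show ?thesis unfolding tempered_distributions_def by blast
qed

text \<open>The exponent \<open>p\<close> may have either sign. The ratio of \<open>1 + r\<close> and \<open>1 + h r\<close> stays between
  \<open>1 / (1 + h)\<close> and \<open>1 + 1 / h\<close>.\<close>

lemma powr_weight_dilate:
  assumes h: "h > 0"
  obtains C :: real where "C > 0" "\<And>r. r \<ge> 0 \<Longrightarrow> (1 + r) powr p \<le> C * (1 + h * r) powr p"
proof (cases "p \<ge> 0")
  case True
  show ?thesis
  proof (rule that[of "(1 + 1 / h) powr p"])
    fix r :: real assume r: "r \<ge> 0"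
    have "1 + r \<le> (1 + 1 / h) * (1 + h * r)" using h r by (simp add: field_simps)
    then have "(1 + r) powr p \<le> ((1 + 1 / h) * (1 + h * r)) powr p"
      using r True by (intro powr_mono2) auto
    then show "(1 + r) powr p \<le> (1 + 1 / h) powr p * (1 + h * r) powr p"
      using h r by (simp add: powr_mult)
  next
    have "1 + 1 / h > 0" using h by (intro add_pos_pos) auto
    then show "0 < (1 + 1 / h) powr p" by simp
  qed
next
  case False
  show ?thesis
  proof (rule that[of "inverse (1 + h) powr p"])
    fix r :: real assume r: "r \<ge> 0"
    have "inverse (1 + h) * (1 + h * r) \<le> 1 + r" using h r by (simp add: field_simps)
    then have "(1 + r) powr p \<le> (inverse (1 + h) * (1 + h * r)) powr p"
      using r h False by (intro powr_mono2') (auto intro!: mult_pos_pos add_pos_nonneg)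
    then show "(1 + r) powr p \<le> inverse (1 + h) powr p * (1 + h * r) powr p"
      using h r by (simp add: powr_mult)
  qed (use h in simp)
qed

text \<open>If \<open>u\<close> has Fourier transform \<open>U\<close>, the new distribution has transform
  \<open>a U(h \<omega>) exp(- i j \<bullet> \<omega>)\<close>. Dilation changes the weight by bounded factors only.\<close>

lemma sobolev_affine:
  fixes u :: "'d::finite functional"
  assumes u: "u \<in> sobolev_space s" and h: "h > 0"
  shows "affine_dist a h j u \<in> sobolev_space s"
proof -
  note U = sobolev_spaceD[OF u]
  let ?u = "fourier_fun u"
  define e where "e = (\<lambda>\<omega>. exp (\<i> * complex_of_real ((- j) \<bullet> \<omega>)))"
  define g where "g \<omega> = a * ?u (h *\<^sub>R \<omega>) * e \<omega>" for \<omega>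
  have e1: "cmod (e \<omega>) = 1" for \<omega> by (simp add: e_def)
  have [measurable]: "?u \<in> borel_measurable borel" by (rule locally_L2_measurable[OF U(2)])
  have [measurable]: "e \<in> borel_measurable borel" unfolding e_def by measurable
  have [measurable]: "g \<in> borel_measurable borel" unfolding g_def[abs_def] by measurable
  have g2: "(cmod (g \<omega>))\<^sup>2 = (cmod a)\<^sup>2 * (cmod (?u (h *\<^sub>R \<omega>)))\<^sup>2" for \<omega>
    by (simp add: g_def norm_mult e1 power_mult_distrib)
  have L: "locally_L2 g"
    unfolding locally_L2_def
  proof (intro conjI allI impI)
    fix K :: "(real^'d) set" assume K: "compact K"
    let ?K = "(\<lambda>x. h *\<^sub>R x) ` K"
    have "compact ?K" using K by (rule compact_scaling)
    then have "integrable lborel (\<lambda>x. indicator ?K x *\<^sub>R (cmod (?u x))\<^sup>2)"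
      using U(2) unfolding locally_L2_def set_integrable_def by blast
    then have "integrable lborel (\<lambda>x. indicator ?K (h *\<^sub>R x + 0) *\<^sub>R (cmod (?u (h *\<^sub>R x + 0)))\<^sup>2)"
      by (rule integrable_lborel_affine[OF h])
    then have "integrable lborel (\<lambda>x. (cmod a)\<^sup>2 * (indicator ?K (h *\<^sub>R x + 0) *\<^sub>R (cmod (?u (h *\<^sub>R x + 0)))\<^sup>2))"
      by (rule integrable_mult_right)
    also have "(\<lambda>x. (cmod a)\<^sup>2 * (indicator ?K (h *\<^sub>R x + 0) *\<^sub>R (cmod (?u (h *\<^sub>R x + 0)))\<^sup>2))
        = (\<lambda>x. indicator K x *\<^sub>R (cmod (g x))\<^sup>2)"
      using h by (auto simp: g2 indicator_def fun_eq_iff)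
    finally show "set_integrable lborel K (\<lambda>x. (cmod (g x))\<^sup>2)" unfolding set_integrable_def .
  qed simp
  have R: "represented_by (fourier_dist (affine_dist a h j u)) g"
    unfolding represented_by_def
  proof
    fix \<psi> :: "real^'d \<Rightarrow> complex" assume \<psi>: "\<psi> \<in> test_functions"
    have [measurable]: "\<psi> \<in> borel_measurable borel"
      by (intro smooth_borel_measurable test_functionsD \<psi>)
    \<comment> \<open>The test function whose Fourier transform is \<open>x \<mapsto> F\<psi>(h x + j)\<close>.\<close>
    define \<eta> where "\<eta> \<omega> = \<psi> ((1 / h) *\<^sub>R \<omega> + 0) * (of_real (inverse (h ^ CARD('d))) * e ((1 / h) *\<^sub>R \<omega>))" for \<omega>
    have e': "(\<lambda>\<omega>. e ((1 / h) *\<^sub>R \<omega>)) = (\<lambda>\<omega>. exp (\<i> * complex_of_real ((- (1 / h) *\<^sub>R j) \<bullet> \<omega>)))"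
      by (simp add: e_def)
    have "1 / h \<noteq> 0" using h by simp
    from test_function_mult[OF test_function_affine[OF \<psi> this, of 0]
        smooth_mult[OF smooth_const smooth_character[of "- (1 / h) *\<^sub>R j", folded e']]]
    have \<eta>: "\<eta> \<in> test_functions"
      unfolding \<eta>_def .
    have F: "fourier \<psi> (h *\<^sub>R x + j) = fourier \<eta> x" for x
    proof -
      have "fourier \<psi> (h *\<^sub>R x + j)
          = (1 / h) ^ CARD('d) *\<^sub>R (LINT \<omega>|lborel. \<psi> ((1 / h) *\<^sub>R \<omega> + 0)
            * exp (- \<i> * of_real ((h *\<^sub>R x + j) \<bullet> ((1 / h) *\<^sub>R \<omega> + 0))))"
        unfolding fourier_def using h by (intro integral_lborel_affine) auto
      also have "\<dots> = (LINT \<omega>|lborel. (1 / h) ^ CARD('d) *\<^sub>R (\<psi> ((1 / h) *\<^sub>R \<omega> + 0)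
            * exp (- \<i> * of_real ((h *\<^sub>R x + j) \<bullet> ((1 / h) *\<^sub>R \<omega> + 0)))))"
        by simp
      also have "\<dots> = (LINT \<omega>|lborel. \<eta> \<omega> * exp (- \<i> * of_real (x \<bullet> \<omega>)))"
      proof (rule Bochner_Integration.integral_cong[OF refl])
        fix \<omega>
        have "(h *\<^sub>R x + j) \<bullet> ((1 / h) *\<^sub>R \<omega> + 0) = x \<bullet> \<omega> - (- j) \<bullet> ((1 / h) *\<^sub>R \<omega>)"
          using h by (simp add: inner_add_left add_divide_distrib)
        then have "exp (- \<i> * complex_of_real ((h *\<^sub>R x + j) \<bullet> ((1 / h) *\<^sub>R \<omega> + 0)))
            = e ((1 / h) *\<^sub>R \<omega>) * exp (- \<i> * of_real (x \<bullet> \<omega>))"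
          by (simp only: e_def exp_add[symmetric] of_real_diff) (simp add: algebra_simps)
        then show "(1 / h) ^ CARD('d) *\<^sub>R (\<psi> ((1 / h) *\<^sub>R \<omega> + 0)
            * exp (- \<i> * of_real ((h *\<^sub>R x + j) \<bullet> ((1 / h) *\<^sub>R \<omega> + 0)))) = \<eta> \<omega> * exp (- \<i> * of_real (x \<bullet> \<omega>))"
          by (simp only: \<eta>_def) (simp add: scaleR_conv_of_real power_one_over inverse_eq_divide)
      qed
      finally show ?thesis unfolding fourier_def .
    qed
    have "fourier_dist (affine_dist a h j u) \<psi> = a * u (\<lambda>x. fourier \<psi> (h *\<^sub>R x + j))"
      using test_function_schwartz[OF \<psi>] by (simp add: fourier_dist_def affine_dist_def)
    also have "\<dots> = a * fourier_dist u \<eta>"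
      using test_function_schwartz[OF \<eta>] by (simp add: fourier_dist_def F)
    also have "\<dots> = a * (LINT \<omega>|lborel. ?u \<omega> * \<eta> \<omega>)"
      using U(3) \<eta> by (simp add: represented_by_def)
    also have "(LINT \<omega>|lborel. ?u \<omega> * \<eta> \<omega>) = h ^ CARD('d) *\<^sub>R (LINT \<omega>|lborel. ?u (h *\<^sub>R \<omega> + 0) * \<eta> (h *\<^sub>R \<omega> + 0))"
      using smooth_borel_measurable[OF test_functionsD(1)[OF \<eta>]]
      by (intro integral_lborel_affine h) measurable
    also have "a * \<dots> = (LINT \<omega>|lborel. a * (h ^ CARD('d) *\<^sub>R (?u (h *\<^sub>R \<omega> + 0) * \<eta> (h *\<^sub>R \<omega> + 0))))"
      by simp
    also have "\<dots> = (LINT \<omega>|lborel. g \<omega> * \<psi> \<omega>)"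
    proof (rule Bochner_Integration.integral_cong[OF refl])
      fix \<omega>
      have "\<eta> (h *\<^sub>R \<omega> + 0) = \<psi> \<omega> * (of_real (inverse (h ^ CARD('d))) * e \<omega>)"
        using h by (simp add: \<eta>_def)
      then show "a * (h ^ CARD('d) *\<^sub>R (?u (h *\<^sub>R \<omega> + 0) * \<eta> (h *\<^sub>R \<omega> + 0))) = g \<omega> * \<psi> \<omega>"
        using h by (simp add: g_def scaleR_conv_of_real[where 'a=complex])
    qed
    finally show "fourier_dist (affine_dist a h j u) \<psi> = (LINT \<omega>|lborel. g \<omega> * \<psi> \<omega>)" .
  qed
  obtain C :: real where C: "C > 0" "\<And>r. r \<ge> 0 \<Longrightarrow> (1 + r) powr (2 * s) \<le> C * (1 + h * r) powr (2 * s)"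
    using powr_weight_dilate[OF h] by blast
  have I: "integrable lborel (energy_density s g)"
  proof (rule Bochner_Integration.integrable_bound)
    show "integrable lborel (\<lambda>\<omega>. (C * (cmod a)\<^sup>2) * energy_density s ?u (h *\<^sub>R \<omega> + 0))"
      by (intro integrable_mult_right integrable_lborel_affine h U)
    have "energy_density s g \<omega> \<le> (C * (cmod a)\<^sup>2) * energy_density s ?u (h *\<^sub>R \<omega> + 0)" for \<omega>
      using mult_right_mono[OF C(2)[of "norm \<omega>"], of "(cmod (g \<omega>))\<^sup>2"] h
      unfolding energy_density_def g2 by (simp add: ac_simps)
    then show "AE \<omega> in lborel. norm (energy_density s g \<omega>)
        \<le> norm ((C * (cmod a)\<^sup>2) * energy_density s ?u (h *\<^sub>R \<omega> + 0))"
      by (intro always_eventually allI) (auto simp: energy_density_nonneg intro: order_trans[OF _ abs_ge_self])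
  qed measurable
  show ?thesis by (rule sobolev_spaceI[OF tempered_affine[OF U(1) h] L R I])
qed

section \<open>Low-pass filtering of a distribution\<close>

text \<open>The truncated transform \<open>g\<close> is integrable, so \<open>\<eta> \<mapsto> c\<^sup>-\<^sup>1 \<integral> g(\<omega>) (\<integral> \<eta>(x) exp(i \<omega> \<bullet> x) dx) d\<omega>\<close> is a tempered distribution;
  with \<open>c\<close> the inversion constant, its Fourier transform is \<open>g\<close>. A square-integrable function supported in a ball is square integrable against
  every weight, so this single distribution lies in all Sobolev spaces.\<close>

lemma low_pass_filter:
  fixes u :: "'d::finite functional"
  assumes u: "u \<in> sobolev_space s"
  obtains v where "\<And>k. v \<in> sobolev_space k"
    "AE \<omega> in lborel. fourier_fun v \<omega> = indicator (cball 0 R) \<omega> *\<^sub>R fourier_fun u \<omega>"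
proof -
  note U = sobolev_spaceD[OF u]
  let ?u = "fourier_fun u"
  define g where "g \<omega> = indicator (cball 0 R) \<omega> *\<^sub>R ?u \<omega>" for \<omega>
  have [measurable]: "?u \<in> borel_measurable borel" by (rule locally_L2_measurable[OF U(2)])
  have [measurable]: "g \<in> borel_measurable borel" unfolding g_def[abs_def]
    by (intro borel_measurable_scaleR borel_measurable_indicator borel_closed closed_cball) measurable
  have gi: "integrable lborel g"
    using locally_L2_set_integrable[OF U(2) compact_cball] unfolding set_integrable_def g_def .
  have gs: "integrable lborel (\<lambda>\<omega>. indicator (cball 0 R) \<omega> *\<^sub>R (cmod (?u \<omega>))\<^sup>2)"
    using U(2) compact_cball unfolding locally_L2_def set_integrable_def by blast
  obtain c where c: "c \<noteq> 0" "\<And>\<psi> \<omega>. \<psi> \<in> test_functions \<Longrightarrow>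
      (LINT x|lborel. fourier \<psi> x * exp (\<i> * of_real (\<omega> \<bullet> x))) = c * \<psi> (\<omega> :: real^'d)"
    by (rule fourier_inversion) blast
  define T where "T \<eta> \<omega> = (LINT x|lborel. \<eta> x * exp (\<i> * of_real (\<omega> \<bullet> x)))" for \<eta> and \<omega> :: "real^'d"
  define v where "v \<eta> = (if \<eta> \<in> schwartz_space then inverse c * (LINT \<omega>|lborel. g \<omega> * T \<eta> \<omega>) else 0)" for \<eta>
  have T_le: "cmod (T \<eta> \<omega>) \<le> (LINT x|lborel. cmod (\<eta> x))" if "\<eta> \<in> schwartz_space" for \<eta> \<omega>
    unfolding T_def by (rule norm_integral_character_le[OF schwartz_integrable(1)[OF that]])
  have Ti: "integrable lborel (\<lambda>\<omega>. g \<omega> * T \<eta> \<omega>)" if \<eta>: "\<eta> \<in> schwartz_space" for \<eta>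
  proof (rule Bochner_Integration.integrable_bound)
    show "integrable lborel (\<lambda>\<omega>. cmod (g \<omega>) * (LINT x|lborel. cmod (\<eta> x)))"
      using gi by simp
    have [measurable]: "\<eta> \<in> borel_measurable borel"
      by (intro smooth_borel_measurable schwartz_smooth \<eta>)
    have "T \<eta> \<in> borel_measurable borel"
      unfolding T_def[abs_def] by measurable
    then show "(\<lambda>\<omega>. g \<omega> * T \<eta> \<omega>) \<in> borel_measurable lborel" by measurable
    show "AE \<omega> in lborel. norm (g \<omega> * T \<eta> \<omega>) \<le> norm (cmod (g \<omega>) * (LINT x|lborel. cmod (\<eta> x)))"
      using T_le[OF \<eta>] by (auto simp: norm_mult intro!: mult_left_mono order_trans[OF _ abs_ge_self])
  qed
  have v_le: "cmod (v \<eta>) \<le> (cmod (inverse c) * (LINT \<omega>|lborel. cmod (g \<omega>))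
      * (LINT x|lborel. inverse ((1 + norm (x :: real^'d)) ^ (CARD('d) + 2)))) * schwartz_seminorm (CARD('d) + 2) \<eta>"
    if \<eta>: "\<eta> \<in> schwartz_space" for \<eta>
  proof -
    let ?I = "LINT x|lborel. inverse ((1 + norm (x :: real^'d)) ^ (CARD('d) + 2))"
    let ?S = "schwartz_seminorm (CARD('d) + 2) \<eta>"
    have "cmod (LINT \<omega>|lborel. g \<omega> * T \<eta> \<omega>) \<le> (LINT \<omega>|lborel. cmod (g \<omega>) * (?I * ?S))"
    proof (rule Bochner_Integration.integral_norm_bound_integral[OF Ti[OF \<eta>]])
      show "integrable lborel (\<lambda>\<omega>. cmod (g \<omega>) * (?I * ?S))" using gi by simp
      show "norm (g \<omega> * T \<eta> \<omega>) \<le> cmod (g \<omega>) * (?I * ?S)" for \<omega>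
        unfolding norm_mult
        by (intro mult_left_mono order_trans[OF T_le[OF \<eta>] schwartz_integrable(2)[OF \<eta>]]) simp
    qed
    also have "\<dots> = (LINT \<omega>|lborel. cmod (g \<omega>)) * (?I * ?S)" by simp
    finally have "cmod (inverse c) * cmod (LINT \<omega>|lborel. g \<omega> * T \<eta> \<omega>)
        \<le> cmod (inverse c) * ((LINT \<omega>|lborel. cmod (g \<omega>)) * (?I * ?S))"
      by (rule mult_left_mono) simp
    then show ?thesis using \<eta> unfolding v_def by (simp add: norm_mult ac_simps)
  qed
  have "v (\<lambda>x. \<psi> x + \<eta> x) = v \<psi> + v \<eta>" if "\<psi> \<in> schwartz_space" "\<eta> \<in> schwartz_space" for \<psi> \<eta>
  proof -
    have "T (\<lambda>x. \<psi> x + \<eta> x) \<omega> = T \<psi> \<omega> + T \<eta> \<omega>" for \<omega>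
      unfolding T_def distrib_right
      by (intro Bochner_Integration.integral_add integrable_mult_character schwartz_integrable that)
    then show ?thesis
      using that Ti by (simp add: v_def schwartz_add distrib_left)
  qed
  moreover have "v (\<lambda>x. b * \<psi> x) = b * v \<psi>" if "\<psi> \<in> schwartz_space" for \<psi> b
  proof -
    have "T (\<lambda>x. b * \<psi> x) \<omega> = b * T \<psi> \<omega>" for \<omega>
      unfolding T_def by (simp add: mult.assoc)
    then show ?thesis
      using that by (simp add: v_def schwartz_cmult mult.left_commute[of _ b])
  qed
  moreover have "\<forall>\<eta>. \<eta> \<notin> schwartz_space \<longrightarrow> v \<eta> = 0" by (simp add: v_def)
  ultimately have v: "v \<in> tempered_distributions"
    unfolding tempered_distributions_def using v_le by blast
  have L: "locally_L2 g"
    unfolding locally_L2_def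
  proof (intro conjI allI impI)
    fix K :: "(real^'d) set" assume K: "compact K"
    then have "K \<in> sets lborel" using borel_compact by simp
    from integrable_mult_indicator[OF this gs]
    have "integrable lborel (\<lambda>x. indicator K x *\<^sub>R (indicator (cball 0 R) x *\<^sub>R (cmod (?u x))\<^sup>2))" .
    also have "(\<lambda>x. indicator K x *\<^sub>R (indicator (cball 0 R) x *\<^sub>R (cmod (?u x))\<^sup>2))
        = (\<lambda>x. indicator K x *\<^sub>R (cmod (g x))\<^sup>2)"
      by (auto simp: g_def indicator_def fun_eq_iff)
    finally show "set_integrable lborel K (\<lambda>x. (cmod (g x))\<^sup>2)" unfolding set_integrable_def .
  qed simp
  have R: "represented_by (fourier_dist v) g"
    unfolding represented_by_def
  proof
    fix \<psi> :: "real^'d \<Rightarrow> complex" assume \<psi>: "\<psi> \<in> test_functions"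
    have "fourier_dist v \<psi> = inverse c * (LINT \<omega>|lborel. g \<omega> * (c * \<psi> \<omega>))"
      using test_function_schwartz[OF \<psi>] fourier_schwartz[OF \<psi>] c(2)[OF \<psi>]
      by (simp add: fourier_dist_def v_def T_def)
    also have "\<dots> = (LINT \<omega>|lborel. inverse c * (g \<omega> * (c * \<psi> \<omega>)))"
      by (rule integral_mult_right_zero[symmetric])
    also have "\<dots> = (LINT \<omega>|lborel. g \<omega> * \<psi> \<omega>)"
      using c(1) by (intro Bochner_Integration.integral_cong) (auto simp: field_simps)
    finally show "fourier_dist v \<psi> = (LINT \<omega>|lborel. g \<omega> * \<psi> \<omega>)" .
  qed
  have "v \<in> sobolev_space k" for k
  proof (rule sobolev_spaceI[OF v L R])
    have "(1 + norm \<omega>) powr (2 * k) \<le> (1 + R) powr (2 * \<bar>k\<bar>)" if "\<omega> \<in> cball 0 R" for \<omega> :: "real^'d"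
    proof -
      have "(1 + norm \<omega>) powr (2 * k) \<le> (1 + norm \<omega>) powr (2 * \<bar>k\<bar>)" by (intro powr_mono) auto
      also have "\<dots> \<le> (1 + R) powr (2 * \<bar>k\<bar>)" using that by (intro powr_mono2) auto
      finally show ?thesis .
    qed
    then have "energy_density k g \<omega> \<le> (1 + R) powr (2 * \<bar>k\<bar>) * (indicator (cball 0 R) \<omega> *\<^sub>R (cmod (?u \<omega>))\<^sup>2)" for \<omega>
      by (cases "\<omega> \<in> cball 0 R") (auto simp: energy_density_def g_def intro!: mult_right_mono)
    then show "integrable lborel (energy_density k g)"
      by (intro Bochner_Integration.integrable_bound[OF integrable_mult_right[OF gs, of "(1 + R) powr (2 * \<bar>k\<bar>)"]])
        (auto simp: energy_density_nonneg intro: order_trans[OF _ abs_ge_self])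
  qed
  moreover have "AE \<omega> in lborel. fourier_fun v \<omega> = g \<omega>"
    by (rule fourier_fun_AE_eq(1)[OF L R])
  ultimately show ?thesis using that unfolding g_def by blast
qed

section \<open>Principal shift-invariant spaces\<close>

lemma translate_dist_eq_affine: "translate_dist j u = affine_dist 1 1 j u"
  by (simp add: translate_dist_def affine_dist_def)

lemma dilate_dist_eq_affine:
  "dilate_dist h (u :: 'd::finite functional) = affine_dist (of_real (h ^ CARD('d))) h 0 u"
  by (simp add: dilate_dist_def affine_dist_def)

text \<open>Together with shift invariance, this shows that the principal space is an intersection of a nonempty
  family and therefore a subset of the Sobolev space.\<close>

lemma closed_subspace_sobolev_space: "closed_subspace s (sobolev_space s)"
  using sobolev_zero by (auto simp: closed_subspace_def intro: sobolev_lincomb(1))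

lemma shift_invariant_sobolev_space: "shift_invariant (sobolev_space s)"
  by (simp add: shift_invariant_def translate_dist_eq_affine sobolev_affine)

lemma principal_space_subset:
  assumes "\<phi> \<in> sobolev_space s" shows "principal_space s \<phi> \<subseteq> sobolev_space s"
  unfolding principal_space_def
  by (intro Inter_lower CollectI conjI closed_subspace_sobolev_space shift_invariant_sobolev_space assms)

lemma principal_space_lincomb:
  assumes "f \<in> principal_space s \<phi>" "g \<in> principal_space s \<phi>"
  shows "(\<lambda>\<psi>. a * f \<psi> + b * g \<psi>) \<in> principal_space s \<phi>"
  unfolding principal_space_def
proof (rule InterI)
  fix A assume A: "A \<in> {A. closed_subspace s A \<and> shift_invariant A \<and> \<phi> \<in> A}"
  then have "f \<in> A" "g \<in> A" using assms unfolding principal_space_def by auto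
  then show "(\<lambda>\<psi>. a * f \<psi> + b * g \<psi>) \<in> A" using A unfolding closed_subspace_def by blast
qed

lemma principal_space_zero: "(\<lambda>\<psi>. 0) \<in> principal_space s \<phi>"
proof -
  have "\<phi> \<in> principal_space s \<phi>" unfolding principal_space_def by blast
  from principal_space_lincomb[OF this this, of 0 0] show ?thesis by simp
qed

text \<open>If \<open>A\<close> is closed in \<open>W\<^sup>t\<close> and shift-invariant and contains \<open>\<phi>\<close>, then \<open>A \<inter> W\<^sup>s\<close> has the same
  properties in \<open>W\<^sup>s\<close>, because convergence in \<open>W\<^sup>s\<close> implies convergence in \<open>W\<^sup>t\<close>.\<close>

lemma principal_space_mono:
  assumes ts: "t \<le> s" and \<phi>: "\<phi> \<in> sobolev_space s"
  shows "principal_space s \<phi> \<subseteq> principal_space t \<phi>"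
proof -
  have "principal_space s \<phi> \<subseteq> A"
    if A: "closed_subspace t A" "shift_invariant A" "\<phi> \<in> A" for A
  proof -
    have A_lin: "(\<lambda>\<psi>. a * f \<psi> + b * g \<psi>) \<in> A" if "f \<in> A" "g \<in> A" for f g a b
      using A(1) that unfolding closed_subspace_def by blast
    have A_closed: "f \<in> A" if "f \<in> sobolev_space t" "\<forall>\<epsilon>>0. \<exists>g\<in>A. sobolev_norm t (f - g) < \<epsilon>" for f
      using A(1) that unfolding closed_subspace_def by blast
    have "closed_subspace s (A \<inter> sobolev_space s)"
      unfolding closed_subspace_def
    proof (intro conjI ballI allI impI)
      show "A \<inter> sobolev_space s \<noteq> {}" using A \<phi> by blast
      show "(\<lambda>\<psi>. a * f \<psi> + b * g \<psi>) \<in> A \<inter> sobolev_space s"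
        if "f \<in> A \<inter> sobolev_space s" "g \<in> A \<inter> sobolev_space s" for f g a b
        using that by (auto intro: A_lin sobolev_lincomb(1))
      fix f assume f: "f \<in> sobolev_space s"
        and approx: "\<forall>\<epsilon>>0. \<exists>g\<in>A \<inter> sobolev_space s. sobolev_norm s (f - g) < \<epsilon>"
      have "\<exists>g\<in>A. sobolev_norm t (f - g) < \<epsilon>" if \<epsilon>: "\<epsilon> > 0" for \<epsilon>
      proof -
        obtain g where g: "g \<in> A" "g \<in> sobolev_space s" "sobolev_norm s (f - g) < \<epsilon>"
          using approx \<epsilon> by blast
        have "sobolev_norm t (f - g) \<le> sobolev_norm s (f - g)"
          by (rule sobolev_space_mono(2)[OF ts sobolev_diff(1)[OF f g(2)]])
        with g show ?thesis by (intro bexI[of _ g]) auto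
      qed
      then show "f \<in> A \<inter> sobolev_space s"
        using A_closed[OF sobolev_space_mono(1)[OF ts f]] f by blast
    qed simp
    moreover have "shift_invariant (A \<inter> sobolev_space s)"
      using A(2) shift_invariant_sobolev_space[of s] unfolding shift_invariant_def by blast
    ultimately have "principal_space s \<phi> \<subseteq> A \<inter> sobolev_space s"
      unfolding principal_space_def using A(3) \<phi> by (intro Inter_lower) simp
    then show ?thesis by blast
  qed
  then show ?thesis unfolding principal_space_def[of t] by blast
qed

lemma dilated_principal_space_add:
  assumes "f \<in> dilate_dist h ` principal_space s \<phi>" "g \<in> dilate_dist h ` principal_space s \<phi>"
  shows "(\<lambda>\<psi>. f \<psi> + g \<psi>) \<in> dilate_dist h ` principal_space s \<phi>"
proof -
  obtain F G where FG: "F \<in> principal_space s \<phi>" "G \<in> principal_space s \<phi>"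
    "f = dilate_dist h F" "g = dilate_dist h G" using assms by blast
  have "(\<lambda>\<psi>. f \<psi> + g \<psi>) = dilate_dist h (\<lambda>\<psi>. 1 * F \<psi> + 1 * G \<psi>)"
    by (simp add: FG(3,4) dilate_dist_def distrib_left)
  then show ?thesis using principal_space_lincomb[OF FG(1,2), of 1 1] by (simp only: imageI)
qed

lemma dilated_principal_space_zero: "(\<lambda>\<psi>. 0) \<in> dilate_dist h ` principal_space s \<phi>"
  by (rule image_eqI[OF _ principal_space_zero]) (simp add: dilate_dist_def)

lemma dilated_principal_space_subset:
  assumes "\<phi> \<in> sobolev_space s" "h > 0"
  shows "dilate_dist h ` principal_space s \<phi> \<subseteq> sobolev_space s"
  using principal_space_subset[OF assms(1)] assms(2) by (auto simp: dilate_dist_eq_affine intro: sobolev_affine)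

section \<open>Improving the error by iterating on low frequencies\<close>

lemma bdd_below_sobolev_norm: "bdd_below ((\<lambda>g. sobolev_norm s (f - g)) ` S)"
  using sobolev_norm_nonneg by (intro bdd_belowI2)

text \<open>The infimum need not be attained; increasing the constant leaves room for an actual approximant, except when
  \<open>\<parallel>f\<parallel>\<^sub>k = 0\<close>, where 0 approximates \<open>f\<close> exactly.\<close>

lemma approximation_order_approximants:
  fixes \<phi> :: "'d::finite functional"
  assumes \<phi>: "\<phi> \<in> sobolev_space s" and ks: "k > s" and ord: "provides_approximation_order s \<phi> k"
  obtains C where "C \<ge> 0" "\<And>(f :: 'd functional) h. f \<in> sobolev_space k \<Longrightarrow> h > 0 \<Longrightarrow>
    \<exists>g \<in> dilate_dist h ` principal_space s \<phi>. sobolev_norm s (f - g) \<le> C * h powr (k - s) * sobolev_norm k f"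
proof -
  obtain C where C: "\<And>f h. f \<in> sobolev_space k \<Longrightarrow> h > 0 \<Longrightarrow>
      (INF g \<in> dilate_dist h ` principal_space s \<phi>. sobolev_norm s (f - g)) \<le> C * h powr (k - s) * sobolev_norm k f"
    using ord unfolding provides_approximation_order_def by blast
  show ?thesis
  proof (rule that[of "\<bar>C\<bar> + 1"])
    fix f :: "'d functional" and h :: real assume f: "f \<in> sobolev_space k" and h: "h > 0"
    let ?S = "dilate_dist h ` principal_space s \<phi>" and ?B = "(\<bar>C\<bar> + 1) * h powr (k - s) * sobolev_norm k f"
    show "\<exists>g\<in>?S. sobolev_norm s (f - g) \<le> ?B"
    proof (cases "sobolev_norm k f = 0")
      case True
      have "f - (\<lambda>\<psi>. 0) = f" by auto
      moreover have "sobolev_norm s f \<le> sobolev_norm k f"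
        using sobolev_space_mono(2)[OF _ f, of s] ks by simp
      ultimately show ?thesis using True dilated_principal_space_zero by (intro bexI[of _ "\<lambda>\<psi>. 0"]) auto
    next
      case False
      then have "sobolev_norm k f > 0" using sobolev_norm_nonneg[of k f] by linarith
      then have "h powr (k - s) * sobolev_norm k f > 0" using h by simp
      then have "C * (h powr (k - s) * sobolev_norm k f) < (\<bar>C\<bar> + 1) * (h powr (k - s) * sobolev_norm k f)"
        by (intro mult_strict_right_mono) auto
      with C[OF f h] have less: "(INF g \<in> ?S. sobolev_norm s (f - g)) < ?B" by (simp only: mult.assoc)
      have ne: "?S \<noteq> {}" using dilated_principal_space_zero by (rule ex_in_conv[THEN iffD1, OF exI])
      from less[unfolded cINF_less_iff[OF ne bdd_below_sobolev_norm]] show ?thesis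
        by (elim bexE) (rule bexI, rule less_imp_le)
    qed
  qed simp
qed

text \<open>On \<open>\<bar>\<omega>\<bar> \<le> R\<close> the weight of \<open>W\<^sup>k\<close> exceeds that of \<open>W\<^sup>s\<close> by at most \<open>(1 + R)\<^sup>k\<^sup>-\<^sup>s\<close>, and outside the
  weight of \<open>W\<^sup>t\<close> is smaller than that of \<open>W\<^sup>s\<close> by at least the factor \<open>R\<^sup>t\<^sup>-\<^sup>s\<close>.\<close>

lemma frequency_split:
  assumes e: "e \<in> sobolev_space s" and R: "R > 0" and sk: "s \<le> k" and ts: "t \<le> s"
  obtains v where "v \<in> sobolev_space k"
    "sobolev_norm k v \<le> (1 + R) powr (k - s) * sobolev_norm s e"
    "sobolev_norm t (e - v) \<le> R powr (t - s) * sobolev_norm s e"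
proof -
  let ?e = "fourier_fun e"
  obtain v where v: "\<And>k. v \<in> sobolev_space k"
    and ae: "AE \<omega> in lborel. fourier_fun v \<omega> = indicator (cball 0 R) \<omega> *\<^sub>R ?e \<omega>"
    using low_pass_filter[OF e, of R] by blast
  have w: "(1 + norm \<omega>) powr (2 * r) = (1 + norm \<omega>) powr (2 * (r - s)) * (1 + norm \<omega>) powr (2 * s)" for r \<omega>
    by (simp add: powr_add[symmetric] algebra_simps)
  have sq: "x powr (2 * r) = (x powr r)\<^sup>2" if "x > 0" for x r :: real
    using that by (simp add: power2_eq_square powr_add[symmetric])
  have low: "sobolev_norm k v \<le> (1 + R) powr (k - s) * sobolev_norm s e"
  proof (rule sobolev_norm_le_if_density_le[OF v e])
    show "AE \<omega> in lborel. energy_density k (fourier_fun v) \<omega>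
        \<le> ((1 + R) powr (k - s))\<^sup>2 * energy_density s ?e \<omega>"
      using ae
    proof eventually_elim
      case (elim \<omega>)
      show ?case
      proof (cases "\<omega> \<in> cball 0 R")
        case True
        then have "(1 + norm \<omega>) powr (2 * (k - s)) \<le> (1 + R) powr (2 * (k - s))"
          using sk by (intro powr_mono2) auto
        then have "(1 + norm \<omega>) powr (2 * k) \<le> ((1 + R) powr (k - s))\<^sup>2 * (1 + norm \<omega>) powr (2 * s)"
          unfolding w[of \<omega> k] using sq[of "1 + R" "k - s"] R by (intro mult_right_mono) auto
        then show ?thesis
          using elim True by (simp add: energy_density_def mult_right_mono flip: mult.assoc)
      qed (simp add: elim energy_density_def)
    qed
  qed simp
  have high: "sobolev_norm t (e - v) \<le> R powr (t - s) * sobolev_norm s e"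
  proof (rule sobolev_norm_le_if_density_le[OF _ e])
    show "e - v \<in> sobolev_space t"
      by (intro sobolev_diff v sobolev_space_mono(1)[OF ts e])
    show "AE \<omega> in lborel. energy_density t (fourier_fun (e - v)) \<omega>
        \<le> (R powr (t - s))\<^sup>2 * energy_density s ?e \<omega>"
      using ae sobolev_diff(2)[OF e v[of s]]
    proof eventually_elim
      case (elim \<omega>)
      show ?case
      proof (cases "\<omega> \<in> cball 0 R")
        case False
        then have "(1 + norm \<omega>) powr (2 * (t - s)) \<le> R powr (2 * (t - s))"
          using ts R by (intro powr_mono2') auto
        then have "(1 + norm \<omega>) powr (2 * t) \<le> (R powr (t - s))\<^sup>2 * (1 + norm \<omega>) powr (2 * s)"
          unfolding w[of \<omega> t] using sq[of R "t - s"] R by (intro mult_right_mono) auto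
        then show ?thesis
          using elim False by (simp add: energy_density_def mult_right_mono flip: mult.assoc)
      qed (simp add: elim energy_density_def)
    qed
  qed simp
  from that[OF v low high] show ?thesis .
qed

theorem proposition11:
  fixes s k t :: real and \<phi> :: "(real^'d::finite \<Rightarrow> complex) \<Rightarrow> complex"
  assumes "k \<ge> 0" and "k > s" and "\<phi> \<in> sobolev_space s"
    and "provides_approximation_order s \<phi> k"
    and "t \<le> s"
  shows "provides_approximation_order t \<phi> k"
proof -
  note ks = \<open>k > s\<close> and \<phi> = \<open>\<phi> \<in> sobolev_space s\<close> and ts = \<open>t \<le> s\<close>
  obtain C where C: "C \<ge> 0" "\<And>f h. f \<in> sobolev_space k \<Longrightarrow> h > 0 \<Longrightarrow>
      \<exists>g \<in> dilate_dist h ` principal_space s \<phi>. sobolev_norm s (f - g) \<le> C * h powr (k - s) * sobolev_norm k f"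
    using approximation_order_approximants[OF \<phi> ks \<open>provides_approximation_order s \<phi> k\<close>] by blast
  \<comment> \<open>The cutoff is small enough for \<open>C (2\<epsilon>)\<^sup>k\<^sup>-\<^sup>s \<le> 1 / 2\<close>, which makes the low-frequency error a contraction.\<close>
  define \<epsilon> where "\<epsilon> = (1 / (2 * (C + 1))) powr (1 / (k - s)) / 2"
  have \<epsilon>: "\<epsilon> > 0" using C(1) by (simp add: \<epsilon>_def)
  have C\<epsilon>: "C * (2 * \<epsilon>) powr (k - s) \<le> 1 / 2"
  proof -
    have "(2 * \<epsilon>) powr (k - s) = 1 / (2 * (C + 1))"
      using C(1) ks by (simp add: \<epsilon>_def powr_powr)
    then have "C * (2 * \<epsilon>) powr (k - s) = C / (2 * (C + 1))" by simp
    also have "\<dots> \<le> 1 / 2" using C(1) by (simp add: divide_simps)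
    finally show ?thesis .
  qed
  define K where "K = C * \<epsilon> powr (t - s)"
  have K: "K \<ge> 0" using C(1) by (simp add: K_def)
  let ?S = "\<lambda>h. dilate_dist h ` principal_space s \<phi>"
  have step: "\<exists>g\<in>?S h. \<exists>v\<in>sobolev_space k. sobolev_norm k v \<le> sobolev_norm k f / 2
      \<and> sobolev_norm t (f - g - v) \<le> K * h powr (k - t) * sobolev_norm k f"
    if f: "f \<in> sobolev_space k" and h: "0 < h" "h \<le> \<epsilon>" for f h
  proof -
    obtain g where g: "g \<in> ?S h" "sobolev_norm s (f - g) \<le> C * h powr (k - s) * sobolev_norm k f"
      using C(2)[OF f h(1)] by blast
    have fs: "f \<in> sobolev_space s" using sobolev_space_mono(1)[OF _ f] ks by simp
    have "g \<in> sobolev_space s" using dilated_principal_space_subset[OF \<phi> h(1)] g(1) by blast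
    then have e: "f - g \<in> sobolev_space s" by (rule sobolev_diff(1)[OF fs])
    let ?R = "\<epsilon> / h"
    have R: "?R > 0" "1 \<le> ?R" using h \<epsilon> by (auto simp: field_simps)
    obtain v where v: "v \<in> sobolev_space k"
      "sobolev_norm k v \<le> (1 + ?R) powr (k - s) * sobolev_norm s (f - g)"
      "sobolev_norm t (f - g - v) \<le> ?R powr (t - s) * sobolev_norm s (f - g)"
      using frequency_split[OF e R(1) less_imp_le[OF ks] ts] by blast
    have "(1 + ?R) powr (k - s) \<le> (2 * ?R) powr (k - s)"
      using R ks by (intro powr_mono2) auto
    also have "\<dots> = (2 * \<epsilon>) powr (k - s) / h powr (k - s)"
      using \<epsilon> h by (simp add: powr_divide)
    finally have "(1 + ?R) powr (k - s) * sobolev_norm s (f - g)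
        \<le> (2 * \<epsilon>) powr (k - s) / h powr (k - s) * (C * h powr (k - s) * sobolev_norm k f)"
      by (intro mult_mono g) (auto simp: sobolev_norm_nonneg)
    also have "\<dots> = C * (2 * \<epsilon>) powr (k - s) * sobolev_norm k f"
      using h by simp
    also have "\<dots> \<le> 1 / 2 * sobolev_norm k f"
      by (intro mult_right_mono C\<epsilon> sobolev_norm_nonneg)
    finally have "sobolev_norm k v \<le> sobolev_norm k f / 2" using v(2) by simp
    moreover have "sobolev_norm t (f - g - v) \<le> K * h powr (k - t) * sobolev_norm k f"
    proof -
      have Rh: "?R powr (t - s) = \<epsilon> powr (t - s) * h powr (s - t)"
        using \<epsilon> h powr_minus_divide[of h "t - s"] by (simp add: powr_divide)
      have hh: "h powr (s - t) * h powr (k - s) = h powr (k - t)"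
        using h by (simp add: powr_add[symmetric])
      note v(3)
      also have "?R powr (t - s) * sobolev_norm s (f - g)
          \<le> ?R powr (t - s) * (C * h powr (k - s) * sobolev_norm k f)"
        by (intro mult_left_mono g) simp
      also have "\<dots> = K * (h powr (s - t) * h powr (k - s)) * sobolev_norm k f"
        unfolding Rh K_def by simp
      also have "\<dots> = K * h powr (k - t) * sobolev_norm k f"
        unfolding hh ..
      finally show ?thesis .
    qed
    ultimately show ?thesis using g(1) v(1) by blast
  qed
  \<comment> \<open>Squares of norms: with \<open>B = K h\<^sup>k\<^sup>-\<^sup>t\<close>, one round turns the bound \<open>a\<close> into \<open>2 B\<^sup>2 + 2 a / 4\<close>, whose fixed point is
    \<open>4 B\<^sup>2\<close>.\<close>
  have iterate: "\<exists>g\<in>?S h. (sobolev_norm t (f - g))\<^sup>2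
      \<le> ((1 / 2) ^ n + 4 * (K * h powr (k - t))\<^sup>2) * (sobolev_norm k f)\<^sup>2"
    if h: "0 < h" "h \<le> \<epsilon>" and f: "f \<in> sobolev_space k" for f h n
    using f
  proof (induction n arbitrary: f)
    case 0
    have "f - (\<lambda>\<psi>. 0) = f" by auto
    moreover have "sobolev_norm t f \<le> sobolev_norm k f"
      using sobolev_space_mono(2)[OF _ 0, of t] ks ts by simp
    then have "(sobolev_norm t f)\<^sup>2 \<le> 1 * (sobolev_norm k f)\<^sup>2"
      using power_mono[OF _ sobolev_norm_nonneg] by simp
    then have "(sobolev_norm t f)\<^sup>2 \<le> (1 + 4 * (K * h powr (k - t))\<^sup>2) * (sobolev_norm k f)\<^sup>2"
      by (rule order_trans) (intro mult_right_mono, auto)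
    ultimately show ?case using dilated_principal_space_zero by (intro bexI[of _ "\<lambda>\<psi>. 0"]) auto
  next
    case (Suc n)
    let ?B = "K * h powr (k - t)" and ?N = "sobolev_norm k f"
    obtain g v where g: "g \<in> ?S h" and v: "v \<in> sobolev_space k" "sobolev_norm k v \<le> ?N / 2"
      and r: "sobolev_norm t (f - g - v) \<le> ?B * ?N"
      using step[OF Suc.prems h] by blast
    obtain g' where g': "g' \<in> ?S h" "(sobolev_norm t (v - g'))\<^sup>2 \<le> ((1 / 2) ^ n + 4 * ?B\<^sup>2) * (sobolev_norm k v)\<^sup>2"
      using Suc.IH[OF v(1)] by blast
    have sub: "x \<in> sobolev_space t" if "x \<in> ?S h" for x
      using dilated_principal_space_subset[OF \<phi> h(1)] that sobolev_space_mono(1)[OF ts] by blast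
    have kt: "x \<in> sobolev_space t" if "x \<in> sobolev_space k" for x :: "'d functional"
      using sobolev_space_mono(1)[OF _ that] ks ts by simp
    have "f - (\<lambda>\<psi>. g \<psi> + g' \<psi>) = (\<lambda>\<psi>. (f - g - v) \<psi> + (v - g') \<psi>)"
      by auto
    then have "(sobolev_norm t (f - (\<lambda>\<psi>. g \<psi> + g' \<psi>)))\<^sup>2
        \<le> 2 * (sobolev_norm t (f - g - v))\<^sup>2 + 2 * (sobolev_norm t (v - g'))\<^sup>2"
      using sobolev_norm_add_sq[of "f - g - v" t "v - g'"] sub[OF g] sub[OF g'(1)] kt[OF v(1)] kt[OF Suc.prems]
      by (simp add: sobolev_diff(1) del: fun_diff_def)
    also have "\<dots> \<le> 2 * (?B * ?N)\<^sup>2 + 2 * (((1 / 2) ^ n + 4 * ?B\<^sup>2) * (?N / 2)\<^sup>2)"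
    proof (intro add_mono mult_left_mono power_mono r sobolev_norm_nonneg)
      show "(sobolev_norm t (v - g'))\<^sup>2 \<le> ((1 / 2) ^ n + 4 * ?B\<^sup>2) * (?N / 2)\<^sup>2"
        by (rule order_trans[OF g'(2)]) (intro mult_left_mono power_mono v sobolev_norm_nonneg, simp)
    qed simp_all
    also have "\<dots> = ((1 / 2) ^ Suc n + 4 * ?B\<^sup>2) * ?N\<^sup>2"
      by (simp add: power_mult_distrib power_divide algebra_simps)
    finally show ?case
      by (rule bexI[where x = "\<lambda>\<psi>. g \<psi> + g' \<psi>"]) (rule dilated_principal_space_add[OF g g'(1)])
  qed
  have bound: "(INF g \<in> dilate_dist h ` principal_space t \<phi>. sobolev_norm t (f - g))
      \<le> (2 * K + \<epsilon> powr (t - k)) * h powr (k - t) * sobolev_norm k f"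
    if f: "f \<in> sobolev_space k" and h: "h > 0" for f h
  proof -
    let ?I = "INF g \<in> dilate_dist h ` principal_space t \<phi>. sobolev_norm t (f - g)"
    let ?N = "sobolev_norm k f" and ?B = "K * h powr (k - t)"
    have upper: "?I \<le> sobolev_norm t (f - g)" if "g \<in> dilate_dist h ` principal_space t \<phi>" for g
      by (rule cINF_lower[OF bdd_below_sobolev_norm that])
    have "?I \<ge> 0"
      using dilated_principal_space_zero by (intro cINF_greatest sobolev_norm_nonneg) blast
    show ?thesis
    proof (cases "h \<le> \<epsilon>")
      case True
      have "?I\<^sup>2 \<le> ((1 / 2) ^ n + 4 * ?B\<^sup>2) * ?N\<^sup>2" for n
      proof -
        obtain g where g: "g \<in> ?S h" "(sobolev_norm t (f - g))\<^sup>2 \<le> ((1 / 2) ^ n + 4 * ?B\<^sup>2) * ?N\<^sup>2"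
          using iterate[OF h True f] by blast
        have "g \<in> dilate_dist h ` principal_space t \<phi>"
          using g(1) principal_space_mono[OF ts \<phi>] by blast
        from power_mono[OF upper[OF this] \<open>?I \<ge> 0\<close>, of 2] g(2) show ?thesis by linarith
      qed
      moreover have "(\<lambda>n. ((1 / 2) ^ n + 4 * ?B\<^sup>2) * ?N\<^sup>2) \<longlonglongrightarrow> (0 + 4 * ?B\<^sup>2) * ?N\<^sup>2"
        by (intro tendsto_intros LIMSEQ_realpow_zero) auto
      ultimately have "?I\<^sup>2 \<le> (0 + 4 * ?B\<^sup>2) * ?N\<^sup>2"
        by (intro LIMSEQ_le_const) auto
      also have "\<dots> = (2 * ?B * ?N)\<^sup>2" by (simp add: power_mult_distrib)
      finally have "?I \<le> 2 * ?B * ?N"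
        by (rule power2_le_imp_le) (use K in \<open>simp add: sobolev_norm_nonneg\<close>)
      also have "\<dots> = (2 * K) * (h powr (k - t) * ?N)" by simp
      also have "\<dots> \<le> (2 * K + \<epsilon> powr (t - k)) * (h powr (k - t) * ?N)"
        by (intro mult_right_mono) (auto simp: sobolev_norm_nonneg)
      finally show ?thesis by (simp only: mult.assoc)
    next
      case False
      have "f - (\<lambda>\<psi>. 0) = f" by auto
      then have "?I \<le> sobolev_norm t f" using upper[OF dilated_principal_space_zero] by (simp only:)
      also have "\<dots> \<le> 1 * ?N" using sobolev_space_mono(2)[OF _ f, of t] ks ts by simp
      also have "\<dots> \<le> (h / \<epsilon>) powr (k - t) * ?N"
        using False \<epsilon> ks ts by (intro mult_right_mono ge_one_powr_ge_zero sobolev_norm_nonneg) auto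
      also have "\<dots> = \<epsilon> powr (t - k) * h powr (k - t) * ?N"
        using \<epsilon> h powr_minus_divide[of \<epsilon> "k - t"] by (simp add: powr_divide)
      also have "\<dots> \<le> (2 * K + \<epsilon> powr (t - k)) * h powr (k - t) * ?N"
        using K by (intro mult_right_mono) (auto simp: sobolev_norm_nonneg)
      finally show ?thesis .
    qed
  qed
  then show ?thesis unfolding provides_approximation_order_def by blast
qed

end
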